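(* Let $\mathit{tw}(n)$ be a function of $n$ and let $\mathcal{G}$ be the family of (connected) graphs of treewidth at most $\mathit{tw}(n)$. Let $\delta_{\mathcal{G}}(n)=\max\{\delta(\mathcal{A}(G)) : G\in\mathcal{G},\ |V(G)|=n\}$. Then $$\Omega(\mathit{tw}(n)\cdot n)\le \delta_{\mathcal{G}}(n)\le O(\mathit{tw}(n)\cdot n\log n).$$
   Context: All graphs are finite, simple and connected. For a graph $G=(V,E)$, a search tree on $G$ is a rooted tree with vertex set $V$ defined recursively: its root is some vertex $r\in V$, and $r$ is joined to the roots of search trees on each connected component of $G-r$. The tubes of a search tree are the vertex sets of its subtrees. Two search trees on $G$ are related by a rotation if their sets of tubes have symmetric difference of size exactly two. The graph associahedron $\mathcal{A}(G)$ is a polytope whose skeleton is isomorphic to the graph on search trees of $G$ with adjacency given by rotations; $\delta(\mathcal{A}(G))$ is the diameter of this graph. Treewidth is the usual graph parameter (one less than the smallest clique number of a chordal supergraph of $G$).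
   Formalization: The lower bound is stated only for tw(n) = O(n); without this it is false (for tw(n) = n² the diameter is O(n² log n), while tw(n)·n = n³), since n-vertex graphs have treewidth at most n−1. The upper bound is unrestricted. *)

theory Defs
  imports
    "Graph_Theory.Graph_Theory"
    "HOL-Library.FSet"
    "HOL-Library.Landau_Symbols"
begin

text \<open>
  Finite simple graphs are the symmetric loop-free finite pair digraphs (\<open>pair_graph\<close>): every
  edge is represented by its two arcs. The name \<open>connected\<close> is always qualified, since
  topological connectedness bears the same name. The library's predicate includes nonemptiness.
\<close>


section \<open>Treewidth\<close>

text \<open>
  By the library's definition of \<open>cycle\<close>, the vertices of a cycle are pairwise distinct. As an arc
  list \<open>p\<close> it has \<open>length p\<close> vertices, which are the tails of its arcs.
\<close>

definition chordal :: "'a pair_pre_digraph \<Rightarrow> bool" where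
  "chordal H \<longleftrightarrow>
    (\<forall>p. pre_digraph.cycle (with_proj H) p \<and> 4 \<le> length p \<longrightarrow>
      (\<exists>u v. (u, v) \<in> parcs H \<and> u \<in> fst ` set p \<and> v \<in> fst ` set p \<and>
             (u, v) \<notin> set p \<and> (v, u) \<notin> set p))"

definition is_clique :: "'a pair_pre_digraph \<Rightarrow> 'a set \<Rightarrow> bool" where
  "is_clique H K \<longleftrightarrow> K \<subseteq> pverts H \<and> (\<forall>u\<in>K. \<forall>v\<in>K. u \<noteq> v \<longrightarrow> (u, v) \<in> parcs H)"

definition clique_number :: "'a pair_pre_digraph \<Rightarrow> nat" where
  "clique_number H = Max {card K | K. is_clique H K}"

definition treewidth :: "'a pair_pre_digraph \<Rightarrow> nat" where
  "treewidth G =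
    (LEAST w. \<exists>H. pair_graph H \<and> subgraph (with_proj G) (with_proj H) \<and> chordal H \<and>
                   clique_number H = w) - 1"


section \<open>Search trees and rotations\<close>

text \<open>Rooted trees with unordered children.\<close>

datatype 'a stree = Node (root: 'a) (children: "'a stree fset")

text \<open>
  In a symmetric digraph the strongly connected components (\<open>sccs\<close>, as induced subgraphs) are
  the connected components of the graph. The function \<open>c\<close> picks one search tree for each of
  them. These trees have disjoint vertex sets, so distinct components yield distinct children.
\<close>

inductive search_tree :: "('a, 'b) pre_digraph \<Rightarrow> 'a stree \<Rightarrow> bool" where
  "\<lbrakk> r \<in> verts G;
     \<forall>C \<in> pre_digraph.sccs (pre_digraph.del_vert G r). search_tree C (c C);
     fset ts = c ` pre_digraph.sccs (pre_digraph.del_vert G r) \<rbrakk>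
   \<Longrightarrow> search_tree G (Node r ts)"

primrec subtrees :: "'a stree \<Rightarrow> 'a stree set" where
  "subtrees (Node r ts) = insert (Node r ts) (\<Union> (fset (subtrees |`| ts)))"

text \<open>The set function \<open>set_stree\<close> of the datatype yields the vertex set of a tree.\<close>

definition tubes :: "'a stree \<Rightarrow> 'a set set" where
  "tubes T = set_stree ` subtrees T"

definition rotation :: "'a stree \<Rightarrow> 'a stree \<Rightarrow> bool" where
  "rotation S T \<longleftrightarrow> card ((tubes S - tubes T) \<union> (tubes T - tubes S)) = 2"

text \<open>The rotation graph is the skeleton of the graph associahedron of \<open>G\<close>.\<close>

definition rotation_graph :: "'a pair_pre_digraph \<Rightarrow> 'a stree pair_pre_digraph" where
  "rotation_graph G =
    \<lparr> pverts = {T. search_tree (with_proj G) T},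
      parcs = {(S, T). search_tree (with_proj G) S \<and> search_tree (with_proj G) T \<and>
                       rotation S T} \<rparr>"


section \<open>Diameters\<close>

definition graph_dist :: "'a pair_pre_digraph \<Rightarrow> 'a \<Rightarrow> 'a \<Rightarrow> nat" where
  "graph_dist H u v = (LEAST k. \<exists>p. pre_digraph.awalk (with_proj H) u p v \<and> length p = k)"

definition diameter :: "'a pair_pre_digraph \<Rightarrow> nat" where
  "diameter H = Max {graph_dist H u v | u v. u \<in> pverts H \<and> v \<in> pverts H}"

definition assoc_diameter :: "'a pair_pre_digraph \<Rightarrow> nat" where
  "assoc_diameter G = diameter (rotation_graph G)"

text \<open>
  Every finite graph is isomorphic to one with vertices in \<open>nat\<close>, so it suffices to range over
  those. On \<open>nat\<close> the supremum of a nonempty set is its \<open>Max\<close>; if there is no graph of order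
  \<open>n\<close> and treewidth at most \<open>k\<close> (for example, if \<open>k = 0\<close> and \<open>n \<ge> 2\<close>), its value is \<open>0\<close>.
\<close>

definition max_assoc_diameter :: "nat \<Rightarrow> nat \<Rightarrow> nat" where
  "max_assoc_diameter k n =
    Sup {assoc_diameter G | G :: nat pair_pre_digraph.
           pair_graph G \<and> Digraph_Component.connected (with_proj G) \<and>
           treewidth G \<le> k \<and> card (pverts G) = n}"

end

theory Submission
  imports Defs
begin

text \<open>
  Upper bound: deleting a suitable clique of a chordal supergraph leaves components of at most half
  the size, so a graph of treewidth \<open>k\<close> on \<open>n\<close> vertices has a search tree of depth
  \<open>O(k log n)\<close>. Every search tree is turned into this one by rotating the prescribed roots to the top,
  recursively. Moving a vertex to the root of a tree on \<open>m\<close> vertices takes fewer than \<open>m\<close> rotations,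
  and the sum of \<open>m\<close> over all tubes of the target tree is at most \<open>n\<close> times its depth.

  Lower bound: a search tree orients every edge from ancestor to descendant, and a rotation reverses
  at most one edge. Two search trees that disagree on all edges are therefore at distance at least
  the number of edges, which is of order \<open>k n\<close> for the join of a clique on \<open>k\<close> vertices and
  \<open>n - k\<close> independent vertices.
\<close>


section \<open>Connected vertex sets and components\<close>

text \<open>Rotations are defined through tubes alone, so both bounds are argued on tubes. A search
  tree has exactly one tube per vertex, hence a rotation exchanges a single tube for another. The
  orientation of an edge shows in the tubes that contain just one of its ends, and every vertex of a
  tube except its root lies in a smaller tube; so the exchange can only reverse an edge between the
  roots of the two exchanged tubes. Balance is measured on an arbitrary vertex set \<open>A\<close>,
  while the clique is taken in a chordal supergraph of the whole graph. The recursion therefore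
  never has to speak of the treewidth of a subgraph. \<open>graph_dist\<close> and
  \<open>diameter\<close> are a \<open>LEAST\<close> and a \<open>Max\<close>, which are informative
  only if distances are attained and their set is finite. This is why the lower bound relies on the
  upper one: that one shows the rotation graph to be connected with bounded distances.\<close>

definition closed_in :: "'a rel \<Rightarrow> 'a set \<Rightarrow> 'a set \<Rightarrow> bool" where
  "closed_in E A X \<longleftrightarrow> X \<subseteq> A \<and> (\<forall>x\<in>X. \<forall>y\<in>A. (x, y) \<in> E \<longrightarrow> y \<in> X)"

text \<open>Connectivity is expressed by cuts: no proper nonempty part is closed under adjacency.\<close>

definition connected_on :: "'a rel \<Rightarrow> 'a set \<Rightarrow> bool" where
  "connected_on E A \<longleftrightarrow> A \<noteq> {} \<and> (\<forall>X. closed_in E A X \<longrightarrow> X \<noteq> {} \<longrightarrow> X = A)"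

definition components :: "'a rel \<Rightarrow> 'a set \<Rightarrow> 'a set set" where
  "components E A = {C. closed_in E A C \<and> connected_on E C}"

lemma components_subset: "C \<in> components E A \<Longrightarrow> C \<subseteq> A"
  by (auto simp: components_def closed_in_def)

lemma components_connected_on: "C \<in> components E A \<Longrightarrow> connected_on E C"
  by (auto simp: components_def)

lemma components_nonempty: "C \<in> components E A \<Longrightarrow> C \<noteq> {}"
  by (auto simp: components_def connected_on_def)

lemma components_closed: "C \<in> components E A \<Longrightarrow> x \<in> C \<Longrightarrow> y \<in> A \<Longrightarrow> (x, y) \<in> E \<Longrightarrow> y \<in> C"
  by (auto simp: components_def closed_in_def)

text \<open>The trace of \<open>D\<close> on \<open>C\<close> is closed in \<open>C\<close> and
  nonempty, so connectivity forces it to be all of \<open>C\<close>.\<close>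

lemma connected_on_subset_closed:
  assumes "connected_on E C" "C \<subseteq> A" "closed_in E A D" "C \<inter> D \<noteq> {}"
  shows "C \<subseteq> D"
proof -
  have "closed_in E C (C \<inter> D)" using assms(2,3) by (auto simp: closed_in_def)
  then have "C \<inter> D = C" using assms(1,4) unfolding connected_on_def by blast
  then show ?thesis by auto
qed

lemma connected_on_subset_comp:
  assumes "connected_on E C" "C \<subseteq> A" "D \<in> components E A" "C \<inter> D \<noteq> {}"
  shows "C \<subseteq> D"
  using assms connected_on_subset_closed unfolding components_def by blast

lemma components_disjoint:
  assumes "C \<in> components E A" "D \<in> components E A" "C \<noteq> D"
  shows "C \<inter> D = {}"
  using assms connected_on_subset_comp[of E C A D] connected_on_subset_comp[of E D A C]
  by (metis components_connected_on components_subset inf_commute subset_antisym)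

lemma components_of_connected_on: "connected_on E A \<Longrightarrow> components E A = {A}"
  by (auto simp: components_def connected_on_def closed_in_def)

lemma finite_components: "finite A \<Longrightarrow> finite (components E A)"
  by (rule finite_subset[of _ "Pow A"]) (auto dest: components_subset)

text \<open>The component of \<open>x\<close> is the smallest closed set containing
  \<open>x\<close>. By symmetry complements of closed sets are closed, so a closed part missing
  \<open>x\<close> would leave a smaller closed set around \<open>x\<close>.\<close>

lemma components_exists:
  assumes "sym E" "x \<in> A"
  shows "\<exists>C\<in>components E A. x \<in> C"
proof -
  define C where "C = \<Inter>{X. closed_in E A X \<and> x \<in> X}"
  have "closed_in E A A" by (auto simp: closed_in_def)
  then have CA: "closed_in E A C"
    using assms(2) unfolding C_def closed_in_def by blast
  have xC: "x \<in> C" by (auto simp: C_def)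
  have min: "C \<subseteq> X" if "closed_in E C X" "x \<in> X" for X
  proof -
    have "closed_in E A X" using that(1) CA unfolding closed_in_def by blast
    then show ?thesis using that(2) by (auto simp: C_def)
  qed
  have "X = C" if X: "closed_in E C X" "X \<noteq> {}" for X
  proof (cases "x \<in> X")
    case True
    then show ?thesis using min X by (auto simp: closed_in_def)
  next
    case False
    have "closed_in E C (C - X)"
      using X(1) assms(1) unfolding closed_in_def sym_def by blast
    then have "C \<subseteq> C - X" using min False xC by blast
    then show ?thesis using X unfolding closed_in_def by blast
  qed
  then have "C \<in> components E A" using CA xC by (auto simp: components_def connected_on_def)
  then show ?thesis using xC by blast
qed

lemma Union_components: "sym E \<Longrightarrow> \<Union>(components E A) = A"
  using components_exists components_subset by (metis Sup_le_iff UnionI subsetI subset_antisym)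

lemma sum_card_components:
  assumes "sym E" "finite A"
  shows "(\<Sum>C\<in>components E A. card C) = card A"
proof -
  have "card (\<Union>(components E A)) = (\<Sum>C\<in>components E A. card C)"
    using components_disjoint[of _ E A] finite_subset[OF components_subset assms(2)]
    by (intro card_Union_disjoint) (blast intro: disjointI)+
  then show ?thesis using Union_components[OF assms(1)] by metis
qed

text \<open>Removing vertices of one component leaves the others untouched, since no edge joins
  them. This allows two successive deletions to be compared in either order.\<close>

lemma components_Diff:
  assumes "sym E" "C \<in> components E A" "X \<subseteq> C"
  shows "components E (A - X) = (components E A - {C}) \<union> components E (C - X)"
proof (intro subset_antisym subsetI)
  fix D assume D: "D \<in> components E (A - X)"
  then obtain x where x: "x \<in> D" using components_nonempty by blast
  then obtain D' where D': "D' \<in> components E A" "x \<in> D'"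
    using components_exists[OF assms(1)] components_subset[OF D] by blast
  have sub: "D \<subseteq> D'"
    using connected_on_subset_comp[OF components_connected_on[OF D] _ D'(1)] components_subset[OF D] x D'(2) by blast
  show "D \<in> components E A - {C} \<union> components E (C - X)"
  proof (cases "D' = C")
    case True
    then have "D \<in> components E (C - X)"
      using D sub components_subset[OF assms(2)] unfolding components_def closed_in_def by blast
    then show ?thesis by blast
  next
    case False
    then have "D' \<inter> X = {}" using components_disjoint[OF D'(1) assms(2)] assms(3) by blast
    then have "closed_in E D' D"
      using D sub components_subset[OF D'(1)] unfolding components_def closed_in_def by blast
    then have "D = D'" using components_connected_on[OF D'(1)] x unfolding connected_on_def by blast
    then show ?thesis using False D' by blast
  qed
next
  fix D assume "D \<in> components E A - {C} \<union> components E (C - X)"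
  then consider "D \<in> components E A" "D \<noteq> C" | "D \<in> components E (C - X)" by blast
  then show "D \<in> components E (A - X)"
  proof cases
    case 1
    then have "D \<inter> X = {}" using components_disjoint[OF 1(1) assms(2)] assms(3) by blast
    then show ?thesis using 1 unfolding components_def closed_in_def by blast
  next
    case 2
    then show ?thesis using assms(2) unfolding components_def closed_in_def by blast
  qed
qed

section \<open>Search trees on vertex sets\<close>

text \<open>
  The induced subgraphs occurring in \<^const>\<open>search_tree\<close> are replaced by their vertex sets,
  with a fixed adjacency relation.
\<close>

inductive search_tree_on :: "'a rel \<Rightarrow> 'a set \<Rightarrow> 'a stree \<Rightarrow> bool" for E where
  "\<lbrakk> r \<in> A; \<forall>C\<in>components E (A - {r}). search_tree_on E C (c C); fset ts = c ` components E (A - {r}) \<rbrakk>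
   \<Longrightarrow> search_tree_on E A (Node r ts)"

text \<open>Children are given by a function on components, so that replacing a subtree is a
  function update. \<open>Abs_fset\<close> is inverted only for finite images.\<close>

definition tree_node :: "'a \<Rightarrow> 'b set \<Rightarrow> ('b \<Rightarrow> 'a stree) \<Rightarrow> 'a stree" where
  "tree_node r F c = Node r (Abs_fset (c ` F))"

lemma search_tree_on_tree_node:
  assumes "finite A" "r \<in> A" "\<And>C. C \<in> components E (A - {r}) \<Longrightarrow> search_tree_on E C (c C)"
  shows "search_tree_on E A (tree_node r (components E (A - {r})) c)"
  unfolding tree_node_def
  by (rule search_tree_on.intros) (use assms in \<open>auto simp: Abs_fset_inverse finite_components\<close>)

lemma tree_node_cong: "(\<And>C. C \<in> F \<Longrightarrow> c C = d C) \<Longrightarrow> tree_node r F c = tree_node r F d"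
  unfolding tree_node_def by (metis image_cong)

lemma set_stree_search_tree_on:
  assumes "search_tree_on E A T" "sym E"
  shows "set_stree T = A"
  using assms(1)
proof induction
  case (1 r A c ts)
  have "(\<Union>t\<in>fset ts. set_stree t) = \<Union>(components E (A - {r}))"
    using 1 by auto
  then show ?case using 1(1) Union_components[OF assms(2), of "A - {r}"] by auto
qed

lemma tubes_Node: "tubes (Node r ts) = insert (set_stree (Node r ts)) (\<Union>t\<in>fset ts. tubes t)"
  unfolding tubes_def by (auto simp: image_Union)

lemma tubes_tree_node:
  assumes "sym E" "finite A" "r \<in> A" "\<And>C. C \<in> components E (A - {r}) \<Longrightarrow> search_tree_on E C (c C)"
  shows "tubes (tree_node r (components E (A - {r})) c) =
    insert A (\<Union>C\<in>components E (A - {r}). tubes (c C))"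
proof -
  have "set_stree (tree_node r (components E (A - {r})) c) = A"
    using set_stree_search_tree_on[OF search_tree_on_tree_node] assms by metis
  then show ?thesis using assms(2)
    unfolding tree_node_def tubes_Node by (simp add: Abs_fset_inverse finite_components)
qed

text \<open>This replaces the generated induction rule: every step receives finiteness and the
  decomposition of the tubes along with the tree.\<close>

lemma search_tree_on_induct [consumes 3, case_names tree_node]:
  assumes "search_tree_on E A T" "sym E" "finite A"
    and "\<And>A r c. \<lbrakk>finite A; r \<in> A; \<And>C. C \<in> components E (A - {r}) \<Longrightarrow> search_tree_on E C (c C);
      \<And>C. C \<in> components E (A - {r}) \<Longrightarrow> P C (c C);
      tubes (tree_node r (components E (A - {r})) c) = insert A (\<Union>C\<in>components E (A - {r}). tubes (c C))\<rbrakk>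
      \<Longrightarrow> P A (tree_node r (components E (A - {r})) c)"
  shows "P A T"
  using assms(1,3)
proof induction
  case (1 r A c ts)
  have ts: "Node r ts = tree_node r (components E (A - {r})) c"
    using 1 by (metis fset_inverse tree_node_def)
  have "P C (c C)" if "C \<in> components E (A - {r})" for C
    using 1 that finite_subset[OF components_subset[OF that]] by blast
  moreover have "search_tree_on E C (c C)" if "C \<in> components E (A - {r})" for C
    using 1 that by blast
  ultimately show ?case unfolding ts using 1 tubes_tree_node[OF assms(2)]
    by (intro assms(4)) auto
qed

lemma tubes_subset:
  assumes "search_tree_on E A T" "sym E" "finite A" "\<tau> \<in> tubes T"
  shows "\<tau> \<subseteq> A \<and> \<tau> \<noteq> {}"
  using assms
proof (induction rule: search_tree_on_induct)
  case (tree_node A r c)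
  then show ?case using components_subset by fastforce
qed

lemma tubes_disjoint:
  assumes "C \<in> components E A" "D \<in> components E A" "C \<noteq> D" "search_tree_on E C S" "search_tree_on E D T" "sym E" "finite A"
  shows "tubes S \<inter> tubes T = {}"
proof -
  have "finite C" "finite D" using assms finite_subset components_subset by metis+
  then show ?thesis
    using tubes_subset[OF assms(4,6)] tubes_subset[OF assms(5,6)] components_disjoint[OF assms(1-3)]
    by blast
qed

text \<open>Each node contributes one new tube: it contains the root, unlike all tubes below it, and
  different children share no tube. The count makes every rotation a one-for-one exchange.\<close>

lemma card_tubes:
  assumes "search_tree_on E A T" "sym E" "finite A"
  shows "finite (tubes T) \<and> card (tubes T) = card A"
  using assms
proof (induction rule: search_tree_on_induct)
  case (tree_node A r c)
  let ?F = "components E (A - {r})"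
  have fin: "finite ?F" using tree_node by (simp add: finite_components)
  have "card (\<Union>C\<in>?F. tubes (c C)) = (\<Sum>C\<in>?F. card (tubes (c C)))"
    using tree_node fin tubes_disjoint[OF _ _ _ tree_node(3) tree_node(3) assms(2)]
    by (intro card_UN_disjoint) auto
  also have "\<dots> = (\<Sum>C\<in>?F. card C)" using tree_node by (intro sum.cong) auto
  also have "\<dots> = card (A - {r})" using tree_node by (intro sum_card_components assms(2)) auto
  finally have 1: "card (\<Union>C\<in>?F. tubes (c C)) = card A - 1" using tree_node by simp
  have "A \<notin> (\<Union>C\<in>?F. tubes (c C))"
  proof
    assume "A \<in> (\<Union>C\<in>?F. tubes (c C))"
    then obtain C where C: "C \<in> ?F" "A \<in> tubes (c C)" by blast
    then have "A \<subseteq> C"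
      using tubes_subset[OF tree_node(3)[OF C(1)] assms(2)] tree_node(1) components_subset[OF C(1)]
      by (meson finite_Diff finite_subset)
    then show False using components_subset[OF C(1)] tree_node(2) by blast
  qed
  moreover have "finite (\<Union>C\<in>?F. tubes (c C))" using tree_node fin by blast
  moreover have "card A > 0" using tree_node(1,2) card_gt_0_iff by blast
  ultimately show ?case using 1 tree_node.hyps(4) by simp
qed

section \<open>Rotation distances\<close>

definition rot_rel :: "'a rel \<Rightarrow> 'a set \<Rightarrow> 'a stree rel" where
  "rot_rel E A = {(S, T). search_tree_on E A S \<and> search_tree_on E A T \<and> rotation S T}"

lemma sym_rot_rel: "sym (rot_rel E A)"
  unfolding rot_rel_def rotation_def sym_def by (auto simp: Un_commute)

lemma relpow_rot_search_tree_on: "(S, T) \<in> rot_rel E A ^^ n \<Longrightarrow> search_tree_on E A S \<Longrightarrow> search_tree_on E A T"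
  by (cases n) (auto simp: rot_rel_def)

text \<open>The tubes outside the subtree on \<open>C\<close> form a set \<open>U\<close> common to
  both trees and disjoint from the tubes of \<open>t\<close> and \<open>t'\<close>, so it cancels in
  the symmetric difference.\<close>

lemma rot_lift:
  assumes "sym E" "finite A" "r \<in> A" "C \<in> components E (A - {r})"
    and search_tree_on: "\<And>D. D \<in> components E (A - {r}) \<Longrightarrow> search_tree_on E D (c D)"
    and "(t, t') \<in> rot_rel E C"
  shows "(tree_node r (components E (A - {r})) (c(C := t)),
          tree_node r (components E (A - {r})) (c(C := t'))) \<in> rot_rel E A"
proof -
  let ?F = "components E (A - {r})"
  have t: "search_tree_on E C t" "search_tree_on E C t'" and rt: "rotation t t'" using assms(6) by (auto simp: rot_rel_def)
  have fC: "finite C" using assms finite_subset components_subset by (metis finite_Diff)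
  define U where "U = insert A (\<Union>D\<in>?F - {C}. tubes (c D))"
  have tub: "tubes (tree_node r ?F (c(C := s))) = tubes s \<union> U \<and> tubes s \<inter> U = {}"
    if s: "search_tree_on E C s" for s
  proof
    have "tubes (tree_node r ?F (c(C := s))) = insert A (\<Union>D\<in>?F. tubes ((c(C := s)) D))"
      using assms s by (intro tubes_tree_node) auto
    also have "(\<Union>D\<in>?F. tubes ((c(C := s)) D)) =
        tubes ((c(C := s)) C) \<union> (\<Union>D\<in>?F - {C}. tubes ((c(C := s)) D))"
      using assms(4) by blast
    also have "(\<Union>D\<in>?F - {C}. tubes ((c(C := s)) D)) = (\<Union>D\<in>?F - {C}. tubes (c D))"
      by (intro SUP_cong) auto
    also have "tubes ((c(C := s)) C) = tubes s" by simp
    also have "insert A (tubes s \<union> (\<Union>D\<in>?F - {C}. tubes (c D))) = tubes s \<union> U"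
      by (simp add: U_def)
    finally show "tubes (tree_node r ?F (c(C := s))) = tubes s \<union> U" .
    have "A \<notin> tubes s" using tubes_subset[OF s assms(1) fC, of A] components_subset[OF assms(4)] assms(3) by blast
    moreover have "tubes s \<inter> tubes (c D) = {}" if "D \<in> ?F - {C}" for D
      using that tubes_disjoint[OF assms(4) _ _ s search_tree_on assms(1), of D] assms(2) by auto
    ultimately show "tubes s \<inter> U = {}" by (auto simp: U_def)
  qed
  have "rotation (tree_node r ?F (c(C := t))) (tree_node r ?F (c(C := t')))"
  proof -
    have "(tubes t \<union> U - (tubes t' \<union> U)) \<union> (tubes t' \<union> U - (tubes t \<union> U)) =
      (tubes t - tubes t') \<union> (tubes t' - tubes t)"
      using tub[OF t(1)] tub[OF t(2)] by blast
    then show ?thesis using rt tub[OF t(1)] tub[OF t(2)] unfolding rotation_def by simp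
  qed
  moreover have "search_tree_on E A (tree_node r ?F (c(C := s)))" if "search_tree_on E C s" for s
    using that assms by (intro search_tree_on_tree_node) auto
  ultimately show ?thesis using t by (auto simp: rot_rel_def)
qed

lemma relpow_rot_lift:
  assumes "sym E" "finite A" "r \<in> A" "C \<in> components E (A - {r})"
    and "\<And>D. D \<in> components E (A - {r}) \<Longrightarrow> search_tree_on E D (c D)"
    and "(c C, t) \<in> rot_rel E C ^^ n"
  shows "(tree_node r (components E (A - {r})) c, tree_node r (components E (A - {r})) (c(C := t)))
    \<in> rot_rel E A ^^ n"
  using assms(6)
proof (induction n arbitrary: t)
  case (Suc n)
  then obtain s where s: "(c C, s) \<in> rot_rel E C ^^ n" "(s, t) \<in> rot_rel E C" by auto
  then show ?case using Suc.IH[OF s(1)] rot_lift[OF assms(1-5) s(2)]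
    unfolding relpow.simps by blast
qed auto

text \<open>Subtrees on different components are changed one after another, so the numbers of
  rotations add up.\<close>

lemma relpow_rot_lift_all:
  assumes "sym E" "finite A" "r \<in> A"
    and c: "\<And>D. D \<in> components E (A - {r}) \<Longrightarrow> search_tree_on E D (c D)"
    and d: "\<And>D. D \<in> components E (A - {r}) \<Longrightarrow> (c D, d D) \<in> rot_rel E D ^^ n D"
  shows "(tree_node r (components E (A - {r})) c, tree_node r (components E (A - {r})) d)
    \<in> rot_rel E A ^^ (\<Sum>D\<in>components E (A - {r}). n D)"
proof -
  let ?F = "components E (A - {r})"
  have dst: "search_tree_on E D (d D)" if "D \<in> ?F" for D
    using relpow_rot_search_tree_on[OF d c] that by blast
  \<comment> \<open>\<open>F\<close> collects the components that already carry their final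
    subtree.\<close>
  have *: "(tree_node r ?F c, tree_node r ?F (\<lambda>D. if D \<in> F then d D else c D)) \<in> rot_rel E A ^^ (\<Sum>D\<in>F. n D)"
    if "finite F" "F \<subseteq> ?F" for F
    using that
  proof induction
    case (insert C F)
    let ?e = "\<lambda>D. if D \<in> F then d D else c D"
    have "(tree_node r ?F ?e, tree_node r ?F (?e(C := d C))) \<in> rot_rel E A ^^ n C"
      using insert c dst d by (intro relpow_rot_lift assms(1-3)) auto
    moreover have "?e(C := d C) = (\<lambda>D. if D \<in> insert C F then d D else c D)" by auto
    ultimately have "(tree_node r ?F c, tree_node r ?F (\<lambda>D. if D \<in> insert C F then d D else c D)) \<in> 
      rot_rel E A ^^ (\<Sum>D\<in>F. n D) O rot_rel E A ^^ n C"
      using insert by auto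
    then show ?case using insert by (simp add: relpow_add[symmetric] add.commute)
  qed auto
  have "tree_node r ?F (\<lambda>D. if D \<in> ?F then d D else c D) = tree_node r ?F d"
    by (rule tree_node_cong) auto
  then show ?thesis using *[of ?F] assms(2) by (simp add: finite_components)
qed

text \<open>
  Both trees have the same subtrees on the components of \<open>A - {a, r}\<close>; the only tubes that differ
  are the component of \<open>A - {a}\<close> containing \<open>r\<close> and the component of \<open>A - {r}\<close> containing \<open>a\<close>.
\<close>

lemma rotate_child_to_root:
  assumes "sym E" "finite A" "a \<in> A" "C \<in> components E (A - {a})" "r \<in> C"
    and c: "\<And>D. D \<in> components E (A - {a}) \<Longrightarrow> D \<noteq> C \<Longrightarrow> search_tree_on E D (c D)"
    and u: "\<And>D. D \<in> components E (C - {r}) \<Longrightarrow> search_tree_on E D (u D)"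
    and cC: "c C = tree_node r (components E (C - {r})) u"
  shows "\<exists>e. (\<forall>D\<in>components E (A - {r}). search_tree_on E D (e D)) \<and>
    (tree_node a (components E (A - {a})) c, tree_node r (components E (A - {r})) e) \<in> rot_rel E A"
proof -
  have rA: "r \<in> A" "r \<noteq> a" using components_subset[OF assms(4)] assms(5) by auto
  obtain B where B: "B \<in> components E (A - {r})" "a \<in> B"
    using components_exists[OF assms(1), of a "A - {r}"] assms(3) rA by auto
  have sub: "C \<subseteq> A - {a}" "B \<subseteq> A - {r}" using components_subset assms(4) B by metis+
  have fin: "finite C" "finite B" using sub assms(2) finite_subset by (metis finite_Diff)+
  let ?R = "components E (A - {a} - {r})"
  have R1: "?R = (components E (A - {a}) - {C}) \<union> components E (C - {r})"
    using components_Diff[OF assms(1,4), of "{r}"] assms(5) by simp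
  have "?R = components E (A - {r} - {a})" by (simp add: Diff_insert2[symmetric] insert_commute)
  then have R2: "?R = (components E (A - {r}) - {B}) \<union> components E (B - {a})"
    using components_Diff[OF assms(1) B(1), of "{a}"] B(2) by simp
  \<comment> \<open>The two families that make up \<open>?R\<close> in \<open>R1\<close> are
    disjoint, so the case distinction in \<open>f\<close> below keeps the old subtree on every child
    other than \<open>C\<close>.\<close>
  have notC: "D \<notin> components E (C - {r})" if "D \<in> components E (A - {a}) - {C}" for D
  proof
    assume "D \<in> components E (C - {r})"
    then have "D \<subseteq> C" "D \<noteq> {}" using components_subset components_nonempty by blast+
    then show False using components_disjoint[OF _ assms(4), of D] that by auto
  qed
  have notB: "D \<notin> components E (B - {a})" if "D \<in> components E (A - {r}) - {B}" for D
  proof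
    assume "D \<in> components E (B - {a})"
    then have "D \<subseteq> B" "D \<noteq> {}" using components_subset components_nonempty by blast+
    then show False using components_disjoint[OF _ B(1), of D] that by auto
  qed
  define f where "f D = (if D \<in> components E (C - {r}) then u D else c D)" for D
  have f: "search_tree_on E D (f D)" if "D \<in> ?R" for D
    using that c u unfolding R1 f_def by auto
  define e where "e = f(B := tree_node a (components E (B - {a})) f)"
  have e: "search_tree_on E D (e D)" if "D \<in> components E (A - {r})" for D
    using that f search_tree_on_tree_node[OF fin(2) B(2), of E f] unfolding R2 e_def by auto
  have stC: "search_tree_on E C (c C)" unfolding cC using fin assms(5) u by (intro search_tree_on_tree_node)
  then have c': "search_tree_on E D (c D)" if "D \<in> components E (A - {a})" for D using c that by blast
  define U where "U = insert A (\<Union>D\<in>?R. tubes (f D))"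
  have "tubes (tree_node a (components E (A - {a})) c) =
    insert A (tubes (c C) \<union> (\<Union>D\<in>components E (A - {a}) - {C}. tubes (c D)))"
    using tubes_tree_node[OF assms(1,2,3), of c] c' assms(4) by auto
  also have "tubes (c C) = insert C (\<Union>D\<in>components E (C - {r}). tubes (u D))"
    unfolding cC using tubes_tree_node[OF assms(1) fin(1) assms(5)] u by auto
  also have "(\<Union>D\<in>components E (A - {a}) - {C}. tubes (c D)) = (\<Union>D\<in>components E (A - {a}) - {C}. tubes (f D))"
    using notC by (auto simp: f_def)
  also have "(\<Union>D\<in>components E (C - {r}). tubes (u D)) = (\<Union>D\<in>components E (C - {r}). tubes (f D))"
    by (auto simp: f_def)
  finally have T1: "tubes (tree_node a (components E (A - {a})) c) = insert C U"
    unfolding U_def R1 by auto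
  have "tubes (tree_node r (components E (A - {r})) e) =
    insert A (tubes (e B) \<union> (\<Union>D\<in>components E (A - {r}) - {B}. tubes (e D)))"
    using tubes_tree_node[OF assms(1,2) rA(1), of e] e B(1) by auto
  also have "(\<Union>D\<in>components E (A - {r}) - {B}. tubes (e D)) = (\<Union>D\<in>components E (A - {r}) - {B}. tubes (f D))"
    by (auto simp: e_def)
  also have "tubes (e B) = insert B (\<Union>D\<in>components E (B - {a}). tubes (f D))"
    using tubes_tree_node[OF assms(1) fin(2) B(2), of f] f unfolding R2 by (auto simp: e_def)
  finally have T2: "tubes (tree_node r (components E (A - {r})) e) = insert B U"
    unfolding U_def R2 by auto
  have tf: "\<tau> \<subseteq> A - {a} - {r}" if "D \<in> ?R" "\<tau> \<in> tubes (f D)" for D \<tau>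
    using tubes_subset[OF f[OF that(1)] assms(1) _ that(2)] components_subset[OF that(1)] assms(2)
    by (metis finite_Diff finite_subset subset_trans)
  \<comment> \<open>\<open>C\<close> contains \<open>r\<close> but not \<open>a\<close>, and
    \<open>B\<close> contains \<open>a\<close> but not \<open>r\<close>; the tubes in
    \<open>U\<close> other than \<open>A\<close> avoid both.\<close>
  have "C \<notin> U" "B \<notin> U" using tf sub assms(3,5) B(2) rA(1) unfolding U_def by auto
  moreover have "C \<noteq> B" using sub assms(5) by auto
  ultimately have "(insert C U - insert B U) \<union> (insert B U - insert C U) = {C, B}" by auto
  then have "rotation (tree_node a (components E (A - {a})) c) (tree_node r (components E (A - {r})) e)"
    unfolding rotation_def T1 T2 using \<open>C \<noteq> B\<close> by simp
  then have "(tree_node a (components E (A - {a})) c, tree_node r (components E (A - {r})) e) \<in> rot_rel E A"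
    unfolding rot_rel_def using search_tree_on_tree_node[OF assms(2) rA(1) e] search_tree_on_tree_node[OF assms(2,3) c'] by auto
  then show ?thesis using e by blast
qed

text \<open>First bring \<open>r\<close> to the root of the child that contains it, then exchange it
  with the old root by one more rotation. That child misses the old root, so the strict bound
  survives the extra rotation.\<close>

lemma rotate_to_root:
  assumes "search_tree_on E A T" "sym E" "finite A" "r \<in> A"
  shows "\<exists>k c. k < card A \<and> (\<forall>C\<in>components E (A - {r}). search_tree_on E C (c C)) \<and>
    (T, tree_node r (components E (A - {r})) c) \<in> rot_rel E A ^^ k"
  using assms
proof (induction rule: search_tree_on_induct)
  case (tree_node A a c)
  show ?case
  proof (cases "r = a")
    case True
    then show ?thesis using tree_node card_gt_0_iff[of A]
      by (intro exI[of _ 0] exI[of _ c]) auto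
  next
    case False
    then obtain C where C: "C \<in> components E (A - {a})" "r \<in> C"
      using components_exists[OF assms(2), of r "A - {a}"] tree_node by auto
    obtain k u where k: "k < card C" and u: "\<And>D. D \<in> components E (C - {r}) \<Longrightarrow> search_tree_on E D (u D)"
      and cu: "(c C, tree_node r (components E (C - {r})) u) \<in> rot_rel E C ^^ k"
      using tree_node.IH[OF C] by blast
    let ?c = "c(C := tree_node r (components E (C - {r})) u)"
    have "(tree_node a (components E (A - {a})) c, tree_node a (components E (A - {a})) ?c) \<in> rot_rel E A ^^ k"
      using tree_node cu C by (intro relpow_rot_lift assms(2)) auto
    moreover obtain e where e: "\<forall>D\<in>components E (A - {r}). search_tree_on E D (e D)"
      "(tree_node a (components E (A - {a})) ?c, tree_node r (components E (A - {r})) e) \<in> rot_rel E A"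
      using rotate_child_to_root[OF assms(2) tree_node(1,2) C, of ?c u]
        tree_node u by auto
    ultimately have "(tree_node a (components E (A - {a})) c, tree_node r (components E (A - {r})) e)
      \<in> rot_rel E A ^^ Suc k" by auto
    moreover have "Suc k < card A"
    proof -
      have "card C \<le> card (A - {a})" using components_subset[OF C(1)] tree_node(1) by (intro card_mono) auto
      then show ?thesis using k tree_node(1,2) card_gt_0_iff[of A] by auto
    qed
    ultimately show ?thesis using e(1) by blast
  qed
qed

section \<open>Eccentricity bounds from prescribed roots\<close>

definition eccentricity_le :: "'a rel \<Rightarrow> 'a set \<Rightarrow> nat \<Rightarrow> bool" where
  "eccentricity_le E A m \<longleftrightarrow>
    (\<exists>T\<^sub>0. search_tree_on E A T\<^sub>0 \<and> (\<forall>T. search_tree_on E A T \<longrightarrow> (\<exists>k\<le>m. (T, T\<^sub>0) \<in> rot_rel E A ^^ k)))"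

lemma eccentricity_le_mono: "eccentricity_le E A m \<Longrightarrow> m \<le> n \<Longrightarrow> eccentricity_le E A n"
  unfolding eccentricity_le_def by (meson le_trans)

text \<open>The target for \<open>A\<close> has root \<open>r\<close> above the targets of the
  components. Fixing one target for all starting trees makes this recursion possible, at the price
  of a factor 2 in the diameter. The term \<open>card A\<close> pays for moving \<open>r\<close> to
  the top.\<close>

lemma eccentricity_le_root:
  assumes "sym E" "finite A" "r \<in> A"
    and m: "\<And>C. C \<in> components E (A - {r}) \<Longrightarrow> eccentricity_le E C (m C)"
  shows "eccentricity_le E A (card A + (\<Sum>C\<in>components E (A - {r}). m C))"
proof -
  let ?F = "components E (A - {r})"
  obtain d where d: "\<And>C. C \<in> ?F \<Longrightarrow> search_tree_on E C (d C)"
    and dk: "\<And>C T. C \<in> ?F \<Longrightarrow> search_tree_on E C T \<Longrightarrow> \<exists>k\<le>m C. (T, d C) \<in> rot_rel E C ^^ k"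
    using m unfolding eccentricity_le_def by metis
  have "\<exists>k\<le>card A + (\<Sum>C\<in>?F. m C). (T, tree_node r ?F d) \<in> rot_rel E A ^^ k" if T: "search_tree_on E A T" for T
  proof -
    obtain k c where k: "k < card A" and c: "\<And>C. C \<in> ?F \<Longrightarrow> search_tree_on E C (c C)"
      and kc: "(T, tree_node r ?F c) \<in> rot_rel E A ^^ k"
      using rotate_to_root[OF T assms(1-3)] by blast
    have "\<forall>C\<in>?F. \<exists>n\<le>m C. (c C, d C) \<in> rot_rel E C ^^ n" using dk c by blast
    then obtain n where n: "\<And>C. C \<in> ?F \<Longrightarrow> n C \<le> m C"
      "\<And>C. C \<in> ?F \<Longrightarrow> (c C, d C) \<in> rot_rel E C ^^ n C" by metis
    have "(tree_node r ?F c, tree_node r ?F d) \<in> rot_rel E A ^^ (\<Sum>C\<in>?F. n C)"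
      using assms n c by (intro relpow_rot_lift_all) auto
    then have "(T, tree_node r ?F d) \<in> rot_rel E A ^^ (k + (\<Sum>C\<in>?F. n C))"
      using kc by (auto simp: relpow_add)
    moreover have "(\<Sum>C\<in>?F. n C) \<le> (\<Sum>C\<in>?F. m C)" using n by (intro sum_mono)
    ultimately show ?thesis using k by (intro exI[of _ "k + (\<Sum>C\<in>?F. n C)"]) auto
  qed
  moreover have "search_tree_on E A (tree_node r ?F d)" using assms d by (intro search_tree_on_tree_node)
  ultimately show ?thesis unfolding eccentricity_le_def by blast
qed

text \<open>The vertices of \<open>S\<close> become roots one at a time. The components present at
  any stage are disjoint, so each vertex of \<open>S\<close> costs at most \<open>card A\<close> in
  total, however many components it is applied to.\<close>

lemma eccentricity_le_separator:
  assumes "sym E" "finite S" "finite A" "connected_on E A"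
    and "\<And>D. D \<in> components E (A - S) \<Longrightarrow> eccentricity_le E D (\<beta> * card D)"
  shows "eccentricity_le E A ((card S + \<beta>) * card A)"
  using assms(2-5)
proof (induction "card S" arbitrary: S A)
  case 0
  then show ?case using components_of_connected_on[of E A] by auto
next
  case (Suc n)
  show ?case
  proof (cases "S \<inter> A = {}")
    \<comment> \<open>The recursion may reach a set that the separator misses; such an
      \<open>A\<close> is itself the only component of \<open>A - S\<close>.\<close>
    case True
    then have "components E (A - S) = {A}" using components_of_connected_on[OF Suc.prems(3)] by (simp add: Diff_triv Int_commute)
    then have "eccentricity_le E A (\<beta> * card A)" using Suc.prems(4) by blast
    then show ?thesis by (rule eccentricity_le_mono) simp
  next
    case False
    then obtain s where s: "s \<in> S" "s \<in> A" by blast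
    have IH: "eccentricity_le E C ((n + \<beta>) * card C)" if C: "C \<in> components E (A - {s})" for C
    proof -
      have "finite C" using components_subset[OF C] Suc.prems finite_subset by (metis finite_Diff)
      moreover have n: "n = card (S - {s})" using Suc s by simp
      \<comment> \<open>Vertices of \<open>S\<close> outside \<open>C\<close> have no effect on the
        components inside \<open>C\<close>.\<close>
      moreover have "components E (C - (S - {s})) \<subseteq> components E (A - S)"
      proof -
        have "components E (C - (S \<inter> C)) \<subseteq> components E (A - {s} - (S \<inter> C))"
          using components_Diff[OF assms(1) C, of "S \<inter> C"] by blast
        moreover have "C - (S \<inter> C) = C - (S - {s})" using components_subset[OF C] by blast
        ultimately have sub: "components E (C - (S - {s})) \<subseteq> components E (A - {s} - (S \<inter> C))" by simp
        have "D \<in> components E (A - S)" if D: "D \<in> components E (C - (S - {s}))" for D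
          using subsetD[OF sub D] components_subset[OF D] components_subset[OF C] s
          unfolding components_def closed_in_def by blast
        then show ?thesis by blast
      qed
      ultimately have "eccentricity_le E C ((card (S - {s}) + \<beta>) * card C)"
        using Suc.prems components_connected_on[OF C] by (intro Suc.hyps(1)) auto
      then show ?thesis using n by simp
    qed
    have "eccentricity_le E A (card A + (\<Sum>C\<in>components E (A - {s}). (n + \<beta>) * card C))"
      using assms(1) Suc.prems s IH by (intro eccentricity_le_root) auto
    moreover have "(\<Sum>C\<in>components E (A - {s}). (n + \<beta>) * card C) = (n + \<beta>) * card (A - {s})"
      using sum_card_components[OF assms(1), of "A - {s}"] Suc.prems by (simp add: sum_distrib_left[symmetric])
    moreover have "(n + \<beta>) * card (A - {s}) \<le> (n + \<beta>) * card A"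
      using Suc.prems by (intro mult_left_mono card_mono) auto
    moreover have "(card S + \<beta>) * card A = card A + (n + \<beta>) * card A"
      using Suc(2) by (simp flip: Suc(2))
    ultimately show ?thesis by (auto intro: eccentricity_le_mono)
  qed
qed


section \<open>Balanced separators\<close>

lemma sym_parcs: "pair_graph G \<Longrightarrow> sym (parcs G)"
  using pair_sym_digraph.pair_sym_arcs[of G]
  by (simp add: symmetric_def pair_graph_def pair_pseudo_graph_def)

lemma finite_pverts: "pair_graph G \<Longrightarrow> finite (pverts G)"
  using pair_fin_digraph.pair_finite_verts[of G]
  by (simp add: pair_graph_def pair_pseudo_graph_def)

lemma irrefl_parcs: "pair_graph G \<Longrightarrow> (v, v) \<notin> parcs G"
  using pair_loopfree_digraph.pair_no_loops[of G "(v, v)"]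
  by (auto simp: pair_graph_def pair_digraph_def)

lemma wf_digraph_pair_graph: "pair_graph G \<Longrightarrow> wf_digraph (with_proj G)"
  by (simp add: wf_digraph_wp_iff pair_graph_def pair_digraph_def pair_fin_digraph_def)

lemma parcs_subset: "pair_graph G \<Longrightarrow> parcs G \<subseteq> pverts G \<times> pverts G"
  using wf_digraph.tail_in_verts[OF wf_digraph_pair_graph] wf_digraph.head_in_verts[OF wf_digraph_pair_graph]
  by fastforce

section \<open>Cycles from vertex lists, chords and induced paths\<close>

lemma pcas_zip: "pcas x (zip (x # xs) (xs @ [y])) y"
  by (induction xs arbitrary: x) auto

lemma pawalk_verts_zip: "pawalk_verts x (zip (x # xs) (xs @ [y])) = x # xs @ [y]"
  by (induction xs arbitrary: x) auto

text \<open>Zipping the vertex list with its cyclic shift yields the arc list that the library calls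
  a cycle.\<close>

lemma cycle_of_vertex_list:
  assumes "distinct vs" "vs \<noteq> []" "set vs \<subseteq> pverts H"
    and "\<And>i. Suc i < length vs \<Longrightarrow> (vs ! i, vs ! Suc i) \<in> parcs H"
    and "(last vs, hd vs) \<in> parcs H"
  shows "pre_digraph.cycle (with_proj H) (zip vs (tl vs @ [hd vs]))"
proof -
  obtain x xs where vs: "vs = x # xs" using assms(2) by (cases vs) auto
  let ?p = "zip (x # xs) (xs @ [x])"
  have "set ?p \<subseteq> parcs H"
  proof
    fix e assume "e \<in> set ?p"
    then obtain i where i: "i < length vs" "e = (vs ! i, (xs @ [x]) ! i)"
      by (auto simp: in_set_conv_nth vs)
    show "e \<in> parcs H"
    proof (cases "Suc i < length vs")
      case True
      then show ?thesis using assms(4)[OF True] i by (simp add: vs nth_append)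
    next
      case False
      then have "i = length xs" using i by (simp add: vs)
      then show ?thesis using assms(5) i last_conv_nth[of vs] by (simp add: vs nth_append)
    qed
  qed
  then have "pre_digraph.awalk (with_proj H) x ?p x"
    unfolding pre_digraph.awalk_def cas_with_proj_eq with_proj_simps
    using pcas_zip[of x xs x] assms(3) by (auto simp: vs)
  moreover have "distinct (tl (pre_digraph.awalk_verts (with_proj H) x ?p))"
    unfolding awalk_verts_with_proj_eq pawalk_verts_zip using assms(1) by (simp add: vs)
  moreover have "?p \<noteq> []" by simp
  ultimately show ?thesis unfolding pre_digraph.cycle_def vs list.sel by blast
qed

text \<open>Restates a chord by positions. Being no arc of the cycle in either direction excludes
  consecutive positions as well as the closing pair of first and last.\<close>

lemma chordal_chord:
  assumes "chordal H" "sym (parcs H)" "\<And>v. (v, v) \<notin> parcs H"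
    and "distinct vs" "4 \<le> length vs" "set vs \<subseteq> pverts H"
    and "\<And>i. Suc i < length vs \<Longrightarrow> (vs ! i, vs ! Suc i) \<in> parcs H"
    and "(last vs, hd vs) \<in> parcs H"
  obtains i j where "Suc i < j" "j < length vs" "i \<noteq> 0 \<or> Suc j \<noteq> length vs"
    "(vs ! i, vs ! j) \<in> parcs H"
proof -
  note chord = that
  let ?p = "zip vs (tl vs @ [hd vs])"
  have ne: "vs \<noteq> []" using assms(5) by auto
  have len: "length (tl vs @ [hd vs]) = length vs" using ne by simp
  have verts: "fst ` set ?p = set vs"
    using len by (metis list.set_map map_fst_zip)
  have "pre_digraph.cycle (with_proj H) ?p"
    using assms(4) ne assms(6,7,8) by (rule cycle_of_vertex_list)
  moreover have "4 \<le> length ?p" using assms(5) len by simp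
  ultimately have "\<exists>u v. (u, v) \<in> parcs H \<and> u \<in> fst ` set ?p \<and> v \<in> fst ` set ?p \<and>
      (u, v) \<notin> set ?p \<and> (v, u) \<notin> set ?p"
    using assms(1) unfolding chordal_def by blast
  then obtain u v where uv: "(u, v) \<in> parcs H" "u \<in> set vs" "v \<in> set vs"
      "(u, v) \<notin> set ?p" "(v, u) \<notin> set ?p"
    unfolding verts by blast
  have p: "(vs ! i, vs ! Suc i) \<in> set ?p" if "Suc i < length vs" for i
    using that len by (auto simp: in_set_conv_nth nth_append nth_tl intro!: exI[of _ i])
  have p0: "(last vs, hd vs) \<in> set ?p"
    using ne len by (auto simp: in_set_conv_nth nth_append last_conv_nth intro!: exI[of _ "length vs - 1"])
  have *: thesis if ij: "i < j" "j < length vs" "(vs ! i, vs ! j) \<in> parcs H"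
    "(vs ! i, vs ! j) \<notin> set ?p" "(vs ! j, vs ! i) \<notin> set ?p" for i j
  proof (rule chord[of i j])
    have "j \<noteq> Suc i" using p[of i] ij(2,4) by auto
    then show "Suc i < j" using ij(1) by simp
    have "last vs = vs ! j" if "Suc j = length vs"
      using that ne by (simp add: last_conv_nth flip: that)
    then show "i \<noteq> 0 \<or> Suc j \<noteq> length vs"
      using p0 ij(5) ne by (auto simp: hd_conv_nth)
  qed (use ij in auto)
  obtain i j where ij: "i < length vs" "u = vs ! i" "j < length vs" "v = vs ! j"
    using uv by (metis in_set_conv_nth)
  have "i \<noteq> j" using uv(1) assms(3) ij by auto
  then show thesis
  proof (cases "i < j")
    case True
    then show thesis using *[of i j] uv ij by simp
  next
    case False
    moreover have "(v, u) \<in> parcs H" using symD[OF assms(2) uv(1)] .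
    ultimately show thesis using *[of j i] uv ij \<open>i \<noteq> j\<close> by simp
  qed
qed

text \<open>A shortest walk in \<open>C\<close> from \<open>x\<close> to \<open>Y\<close> will do.
  One exists because the ends of walks from \<open>x\<close> form a closed set; a chord or an
  earlier visit to \<open>Y\<close> would permit a shorter one.\<close>

lemma induced_path_exists:
  assumes "connected_on E C" "x \<in> C" "C \<inter> Y \<noteq> {}"
  obtains xs where "xs \<noteq> []" "set xs \<subseteq> C" "hd xs = x" "last xs \<in> Y" "distinct xs"
    "\<And>i. Suc i < length xs \<Longrightarrow> (xs ! i, xs ! Suc i) \<in> E"
    "\<And>i j. Suc i < j \<Longrightarrow> j < length xs \<Longrightarrow> (xs ! i, xs ! j) \<notin> E"
    "\<And>i. Suc i < length xs \<Longrightarrow> xs ! i \<notin> Y"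
proof -
  define Q where "Q xs \<longleftrightarrow> xs \<noteq> [] \<and> set xs \<subseteq> C \<and> hd xs = x \<and> successively (\<lambda>a b. (a, b) \<in> E) xs"
    for xs
  have "closed_in E C {last xs | xs. Q xs}"
  proof -
    have "\<exists>ys. y = last ys \<and> Q ys" if "Q xs" "y \<in> C" "(last xs, y) \<in> E" for xs y
      using that by (intro exI[of _ "xs @ [y]"]) (auto simp: Q_def successively_append_iff)
    then show ?thesis unfolding closed_in_def by (auto simp: Q_def)
  qed
  moreover have "x \<in> {last xs | xs. Q xs}"
    using assms(2) by (intro CollectI exI[of _ "[x]"]) (auto simp: Q_def)
  ultimately have "{last xs | xs. Q xs} = C" using assms(1) unfolding connected_on_def by blast
  then obtain xs\<^sub>0 where "Q xs\<^sub>0" "last xs\<^sub>0 \<in> Y" using assms(3) by blast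
  then obtain xs where xs: "Q xs" "last xs \<in> Y"
    and min: "\<And>ys. Q ys \<Longrightarrow> last ys \<in> Y \<Longrightarrow> length xs \<le> length ys"
    using ex_has_least_nat[of "\<lambda>xs. Q xs \<and> last xs \<in> Y" xs\<^sub>0 length] by blast
  have ne: "xs \<noteq> []" using xs by (auto simp: Q_def)
  have E: "(xs ! i, xs ! Suc i) \<in> E" if "Suc i < length xs" for i
    using xs(1) that unfolding Q_def successively_conv_nth by auto
  have pre: "Q (take (Suc i) xs) \<and> last (take (Suc i) xs) = xs ! i" if "i < length xs" for i
  proof
    show "Q (take (Suc i) xs)"
      using xs(1) that unfolding Q_def successively_conv_nth
      by (auto simp: hd_take dest: in_set_takeD)
    show "last (take (Suc i) xs) = xs ! i"
      using that by (simp add: take_Suc_conv_app_nth)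
  qed
  have nY: "xs ! i \<notin> Y" if i: "Suc i < length xs" for i
    using min[of "take (Suc i) xs"] pre[of i] i by auto
  have nE: "(xs ! i, xs ! j) \<notin> E" if ij: "Suc i < j" "j < length xs" for i j
  proof
    assume e: "(xs ! i, xs ! j) \<in> E"
    let ?ys = "take (Suc i) xs @ drop j xs"
    have "successively (\<lambda>a b. (a, b) \<in> E) (drop j xs)"
      using xs(1) unfolding Q_def successively_conv_nth by auto
    then have "Q ?ys" using pre[of i] ij e xs(1) unfolding Q_def
      by (auto simp: successively_append_iff hd_drop_conv_nth dest: in_set_dropD)
    moreover have "last ?ys \<in> Y" using xs(2) ij by simp
    ultimately show False using min[of ?ys] ij by auto
  qed
  \<comment> \<open>If a vertex occurs at both \<open>i\<close> and \<open>j\<close>, the edge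
    leaving position \<open>j\<close> is a shortcut from \<open>i\<close>; if \<open>j\<close> is
    the last position, then position \<open>i\<close> already lies in \<open>Y\<close>.\<close>
  have "xs ! i \<noteq> xs ! j" if ij: "i < j" "j < length xs" for i j
  proof
    assume eq: "xs ! i = xs ! j"
    show False
    proof (cases "Suc j < length xs")
      case True
      then show False using nE[of i "Suc j"] E[of j] eq ij by auto
    next
      case False
      then have "last xs = xs ! i" using eq ij ne
        by (metis Suc_lessI diff_Suc_1 last_conv_nth)
      then show False using nY[of i] xs(2) ij by auto
    qed
  qed
  then have "distinct xs" unfolding distinct_conv_nth by (metis nat_neq_iff)
  then show thesis using that[of xs] xs ne E nE nY by (auto simp: Q_def)
qed

text \<open>
  If \<open>x \<in> C\<close> sees as many vertices of \<open>K\<close> as possible but misses \<open>y\<close>, follow an induced path in \<open>C\<close>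
  from \<open>x\<close> to the neighbourhood of \<open>y\<close>: by chordality, its end sees \<open>y\<close> and all that \<open>x\<close> sees.
\<close>

lemma chordal_common_neighbour:
  assumes H: "pair_graph H" "chordal H" and K: "is_clique H K"
    and C: "connected_on (parcs H) C" "C \<subseteq> pverts H" "C \<inter> K = {}"
    and nb: "\<And>y. y \<in> K \<Longrightarrow> \<exists>c\<in>C. (c, y) \<in> parcs H"
  shows "\<exists>x\<in>C. \<forall>y\<in>K. (x, y) \<in> parcs H"
proof -
  let ?E = "parcs H"
  have sym: "sym ?E" using sym_parcs[OF H(1)] .
  have irr: "(v, v) \<notin> ?E" for v using irrefl_parcs[OF H(1)] .
  have KV: "K \<subseteq> pverts H" using K by (simp add: is_clique_def)
  then have finK: "finite K" using finite_pverts[OF H(1)] by (rule finite_subset)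
  obtain x\<^sub>0 where "x\<^sub>0 \<in> C" using C(1) by (auto simp: connected_on_def)
  moreover have "card {z \<in> K. (x, z) \<in> ?E} \<le> card K" for x using finK by (intro card_mono) auto
  ultimately have "\<exists>x. x \<in> C \<and> (\<forall>x'. x' \<in> C \<longrightarrow> card {z \<in> K. (x', z) \<in> ?E} \<le> card {z \<in> K. (x, z) \<in> ?E})"
    by (intro ex_has_greatest_nat[of _ x\<^sub>0 _ "Suc (card K)"]) (auto simp: less_Suc_eq_le)
  then obtain x where x: "x \<in> C"
    and max: "\<And>x'. x' \<in> C \<Longrightarrow> card {z \<in> K. (x', z) \<in> ?E} \<le> card {z \<in> K. (x, z) \<in> ?E}"
    by blast
  have "(x, y) \<in> ?E" if y: "y \<in> K" for y
  proof (rule ccontr)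
    assume xy: "(x, y) \<notin> ?E"
    have "C \<inter> {c. (c, y) \<in> ?E} \<noteq> {}" using nb[OF y] by blast
    from induced_path_exists[OF C(1) x this]
    obtain xs where xs: "xs \<noteq> []" "set xs \<subseteq> C" "hd xs = x" "(last xs, y) \<in> ?E" "distinct xs"
      and E: "\<And>i. Suc i < length xs \<Longrightarrow> (xs ! i, xs ! Suc i) \<in> ?E"
      and nE: "\<And>i j. Suc i < j \<Longrightarrow> j < length xs \<Longrightarrow> (xs ! i, xs ! j) \<notin> ?E"
      and nY: "\<And>i. Suc i < length xs \<Longrightarrow> (xs ! i, y) \<notin> ?E"
      by auto
    \<comment> \<open>Otherwise the stretch of the path from its last neighbour of \<open>z\<close>
      onwards, closed up through \<open>y\<close> and \<open>z\<close>, would be a chordless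
      cycle.\<close>
    have last: "(last xs, z) \<in> ?E" if z: "z \<in> K" "(x, z) \<in> ?E" for z
    proof (rule ccontr)
      assume lz: "(last xs, z) \<notin> ?E"
      have "z \<noteq> y" using z xy by auto
      then have zy: "(z, y) \<in> ?E" using K z(1) y by (simp add: is_clique_def)
      have "0 < length xs \<and> (xs ! 0, z) \<in> ?E" using xs z by (simp add: hd_conv_nth)
      then have "\<exists>i. (i < length xs \<and> (xs ! i, z) \<in> ?E) \<and>
          (\<forall>j. j < length xs \<and> (xs ! j, z) \<in> ?E \<longrightarrow> j \<le> i)"
        by (intro ex_has_greatest_nat[of _ 0 "\<lambda>i. i" "length xs"]) auto
      then obtain i where i: "i < length xs" "(xs ! i, z) \<in> ?E"
        and imax: "\<And>j. j < length xs \<Longrightarrow> (xs ! j, z) \<in> ?E \<Longrightarrow> j \<le> i"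
        by blast
      \<comment> \<open>At least two path vertices remain; with \<open>y\<close> and
        \<open>z\<close> they give the length four that \<open>chordal\<close> requires.\<close>
      have i': "Suc i < length xs"
      proof (rule ccontr)
        assume "\<not> Suc i < length xs"
        then have "i = length xs - 1" using i by simp
        then show False using lz i xs by (simp add: last_conv_nth)
      qed
      define ys where "ys = drop i xs"
      have ys: "length ys \<ge> 2" "set ys \<subseteq> C" "distinct ys" "last ys = last xs" "ys ! 0 = xs ! i"
        using i' xs set_drop_subset[of i xs] by (auto simp: ys_def)
      have ysE: "(ys ! j, ys ! Suc j) \<in> ?E" if "Suc j < length ys" for j
        using E[of "i + j"] that by (simp add: ys_def)
      have ysnE: "(ys ! j, ys ! k) \<notin> ?E" if "Suc j < k" "k < length ys" for j k
        using nE[of "i + j" "i + k"] that by (simp add: ys_def)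
      have ysz: "(ys ! j, z) \<notin> ?E" if "0 < j" "j < length ys" for j
      proof -
        have "i + j < length xs" using that by (simp add: ys_def)
        then show ?thesis using imax[of "i + j"] that(1) by (auto simp: ys_def)
      qed
      have ysy: "(ys ! j, y) \<notin> ?E" if "Suc j < length ys" for j
        using nY[of "i + j"] that by (simp add: ys_def)
      let ?vs = "z # ys @ [y]"
      have ysK: "z \<notin> set ys" "y \<notin> set ys" using ys(2) C(3) z(1) y by blast+
      have dist: "distinct ?vs" using ys(3) ysK \<open>z \<noteq> y\<close> by simp
      have len: "4 \<le> length ?vs" using ys(1) by simp
      have sub: "set ?vs \<subseteq> pverts H"
        using subset_trans[OF ys(2) C(2)] subsetD[OF KV z(1)] subsetD[OF KV y] by simp
      have adj: "(?vs ! k, ?vs ! Suc k) \<in> ?E" if k: "Suc k < length ?vs" for k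
      proof (cases k)
        case 0
        have "0 < length ys" using ys(1) by linarith
        then show ?thesis using ys(5) 0 symD[OF sym i(2)] by (simp add: nth_append)
      next
        case (Suc m)
        show ?thesis
        proof (cases "Suc m < length ys")
          case True
          then show ?thesis using ysE[OF True] Suc by (simp add: nth_append)
        next
          case False
          then have m: "Suc m = length ys" using k Suc by simp
          then have "last ys = ys ! m" using last_conv_nth[of ys] by (cases ys) auto
          then have "(ys ! m, y) \<in> ?E" using xs(4) ys(4) by simp
          then show ?thesis using m Suc by (simp add: nth_append flip: m)
        qed
      qed
      have "(last ?vs, hd ?vs) \<in> ?E" using symD[OF sym zy] by simp
      from chordal_chord[OF H(2) sym irr dist len sub adj this]
      obtain a b where ab: "Suc a < b" "b < length ?vs" "a \<noteq> 0 \<or> Suc b \<noteq> length ?vs"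
          "(?vs ! a, ?vs ! b) \<in> ?E" .
      \<comment> \<open>Position 0 is \<open>z\<close> and the last position is \<open>y\<close>. A
        chord at \<open>z\<close> contradicts the choice of \<open>i\<close>, one inside the path
        contradicts its being induced, and one at \<open>y\<close> the fact that only the end of the
        path sees \<open>y\<close>.\<close>
      obtain b' where b': "b = Suc b'" using ab by (cases b) auto
      show False
      proof (cases a)
        case 0
        then have "0 < b'" "b' < length ys" using ab b' by auto
        then show False using ysz[of b'] symD[OF sym ab(4)] 0 b' by (simp add: nth_append)
      next
        case (Suc a')
        show False
        proof (cases "b' < length ys")
          case True
          then show False using ysnE[of a' b'] ab Suc b' by (simp add: nth_append)
        next
          case False
          then show False using ysy[of a'] ab Suc b' by (simp add: nth_append)
        qed
      qed
    qed
    have "{z \<in> K. (x, z) \<in> ?E} \<subset> {z \<in> K. (last xs, z) \<in> ?E}"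
      using last xs(4) y xy by blast
    then have "card {z \<in> K. (x, z) \<in> ?E} < card {z \<in> K. (last xs, z) \<in> ?E}"
      using finK by (intro psubset_card_mono) auto
    moreover have "last xs \<in> C" using xs(1,2) last_in_set[of xs] by blast
    ultimately show False using max[of "last xs"] by simp
  qed
  then show ?thesis using x by blast
qed

text \<open>
  Otherwise choose a clique \<open>K\<close> whose heavy component \<open>D\<close> is as small as possible. Adding a vertex of
  \<open>D\<close> adjacent to all vertices of \<open>K\<close> that have neighbours in \<open>D\<close> shrinks the heavy component.
\<close>

lemma chordal_balanced_separator:
  assumes H: "pair_graph H" "chordal H" and "finite A"
  shows "\<exists>K. is_clique H K \<and>
    (\<forall>D\<in>components (parcs H) (pverts H - K). 2 * card (D \<inter> A) \<le> card A)"
proof (rule ccontr)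
  assume no: "\<not> ?thesis"
  let ?E = "parcs H" and ?V = "pverts H"
  have sym: "sym ?E" using sym_parcs[OF H(1)] .
  define Q where "Q KD \<longleftrightarrow> is_clique H (fst KD) \<and> snd KD \<in> components ?E (?V - fst KD) \<and>
    card A < 2 * card (snd KD \<inter> A)" for KD
  have ex: "\<exists>D. Q (K, D)" if "is_clique H K" for K
    using no that unfolding Q_def by (simp add: not_le) blast
  have "is_clique H {}" by (simp add: is_clique_def)
  then obtain D\<^sub>0 where "Q ({}, D\<^sub>0)" using ex by blast
  then obtain K D where KD: "Q (K, D)" and min: "\<And>K' D'. Q (K', D') \<Longrightarrow> card D \<le> card D'"
    using ex_has_least_nat[of Q _ "\<lambda>KD. card (snd KD)"] by (metis prod.collapse snd_conv)
  define K' where "K' = {y \<in> K. \<exists>c\<in>D. (c, y) \<in> ?E}"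
  have K: "is_clique H K" and D: "D \<in> components ?E (?V - K)" and big: "card A < 2 * card (D \<inter> A)"
    using KD by (auto simp: Q_def)
  have DV: "D \<subseteq> ?V - K" using components_subset[OF D] .
  have K': "is_clique H K'" using K by (auto simp: K'_def is_clique_def)
  have "\<exists>x\<in>D. \<forall>y\<in>K'. (x, y) \<in> ?E"
    by (rule chordal_common_neighbour[OF H K' components_connected_on[OF D]]) (use DV in \<open>auto simp: K'_def\<close>)
  then obtain x where x: "x \<in> D" "\<And>y. y \<in> K' \<Longrightarrow> (x, y) \<in> ?E" by blast
  have "is_clique H (insert x K')"
    using K' x DV by (auto simp: is_clique_def intro: symD[OF sym])
  then obtain D' where D': "Q (insert x K', D')" using ex by blast
  have D'c: "D' \<in> components ?E (?V - insert x K')" and big': "card A < 2 * card (D' \<inter> A)"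
    using D' by (auto simp: Q_def)
  \<comment> \<open>Both sets contain more than half of \<open>A\<close>.\<close>
  have "D' \<inter> D \<noteq> {}"
  proof
    assume "D' \<inter> D = {}"
    then have "card (D' \<inter> A) + card (D \<inter> A) = card ((D' \<inter> A) \<union> (D \<inter> A))"
      using assms(3) by (intro card_Un_disjoint[symmetric]) auto
    also have "\<dots> \<le> card A" using assms(3) by (intro card_mono) auto
    finally show False using big big' by simp
  qed
  \<comment> \<open>Vertices of \<open>K\<close> outside \<open>K'\<close> have no neighbour in
    \<open>D\<close>, so \<open>D\<close> stays closed when they are put back. Hence the connected
    set \<open>D'\<close>, which avoids \<open>K'\<close> and meets \<open>D\<close>, cannot leave
    \<open>D\<close>.\<close>
  moreover have "closed_in ?E (?V - K') D"
    using D DV unfolding components_def closed_in_def K'_def by blast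
  ultimately have "D' \<subseteq> D"
    using connected_on_subset_closed[OF components_connected_on[OF D'c], of "?V - K'" D] components_subset[OF D'c] by blast
  moreover have "x \<notin> D'" using components_subset[OF D'c] by blast
  ultimately have "D' \<subset> D" using x by blast
  moreover have "finite D"
    using DV finite_pverts[OF H(1)] by (meson finite_Diff finite_subset)
  ultimately have "card D' < card D" by (intro psubset_card_mono)
  then show False using min[OF D'] by simp
qed

section \<open>Complete split graphs, as chordal supergraphs and as extremal graphs\<close>

definition split_graph :: "'a set \<Rightarrow> 'a set \<Rightarrow> 'a pair_pre_digraph" where
  "split_graph V K =
    \<lparr> pverts = V, parcs = {(u, v). u \<in> V \<and> v \<in> V \<and> u \<noteq> v \<and> (u \<in> K \<or> v \<in> K)} \<rparr>"

lemma pair_graph_split_graph: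
  assumes "finite V"
  shows "pair_graph (split_graph V K)"
proof
  show "finite (parcs (split_graph V K))"
    by (rule finite_subset[of _ "V \<times> V"]) (use assms in \<open>auto simp: split_graph_def\<close>)
  show "symmetric (with_proj (split_graph V K))"
    by (auto simp: split_graph_def symmetric_def sym_def)
qed (use assms in \<open>auto simp: split_graph_def\<close>)

text \<open>Tails and heads of a closed walk form the same multiset, so the distinctness of the
  heads, which the definition of a cycle provides, carries over to the tails.\<close>

lemma cycle_map_fst_snd:
  assumes "pre_digraph.cycle (with_proj H) p"
  shows "distinct (map fst p)" "distinct (map snd p)" "snd ` set p = fst ` set p"
proof -
  obtain u where u: "pcas u p u" "distinct (tl (pawalk_verts u p))" "p \<noteq> []"
    using assms unfolding pre_digraph.cycle_def pre_digraph.awalk_def cas_with_proj_eq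
      awalk_verts_with_proj_eq by blast
  have snd: "pcas a q b \<Longrightarrow> pawalk_verts a q = a # map snd q" for a b :: 'a and q
    by (induction q arbitrary: a) auto
  have fst: "pcas a q b \<Longrightarrow> pawalk_verts a q = map fst q @ [b]" for a b :: 'a and q
    by (induction q arbitrary: a) auto
  show d: "distinct (map snd p)" using snd[OF u(1)] u(2) by simp
  have "map fst p @ [u] = u # map snd p" using fst[OF u(1)] snd[OF u(1)] by simp
  then have "mset (map fst p @ [u]) = mset (u # map snd p)" by (simp only:)
  then have m: "mset (map fst p) = mset (map snd p)" by simp
  then show "distinct (map fst p)" using d mset_eq_imp_distinct_iff by blast
  show "snd ` set p = fst ` set p" using mset_eq_setD[OF m] by simp
qed

text \<open>Every edge has an end in \<open>K\<close>, so a cycle contains some \<open>u\<close> in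
  \<open>K\<close>. This \<open>u\<close> is adjacent to all other vertices but has one successor
  \<open>a\<close> and one predecessor \<open>b\<close> on the cycle; among four vertices one
  differs from \<open>u\<close>, \<open>a\<close> and \<open>b\<close>.\<close>

lemma chordal_split_graph: "chordal (split_graph V K)"
  unfolding chordal_def
proof (intro allI impI)
  fix p assume p: "pre_digraph.cycle (with_proj (split_graph V K)) p \<and> 4 \<le> length p"
  then obtain w where w: "pcas w p w" "p \<noteq> []" "set p \<subseteq> parcs (split_graph V K)"
    unfolding pre_digraph.cycle_def pre_digraph.awalk_def cas_with_proj_eq by auto
  have d: "distinct (map fst p)" "distinct (map snd p)" and sf: "snd ` set p = fst ` set p"
    using cycle_map_fst_snd p by blast+
  obtain e where e: "e \<in> set p" using w(2) list.set_sel(1) by blast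
  then have "e \<in> parcs (split_graph V K)" using w(3) by blast
  then have "fst e \<in> K \<or> snd e \<in> K" by (auto simp: split_graph_def)
  moreover have "fst e \<in> fst ` set p" "snd e \<in> fst ` set p" using e sf by auto
  ultimately obtain u where u: "u \<in> fst ` set p" "u \<in> K" by blast
  have V: "fst ` set p \<subseteq> V" using w(3) by (auto simp: split_graph_def)
  have out: "\<exists>a. \<forall>v. (u, v) \<in> set p \<longrightarrow> v = a"
    using d(1) by (metis (no_types, lifting) distinct_map fst_conv inj_onD prod.inject)
  have inn: "\<exists>b. \<forall>v. (v, u) \<in> set p \<longrightarrow> v = b"
    using d(2) by (metis (no_types, lifting) distinct_map snd_conv inj_onD prod.inject)
  obtain a b where ab: "\<And>v. (u, v) \<in> set p \<Longrightarrow> v = a" "\<And>v. (v, u) \<in> set p \<Longrightarrow> v = b"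
    using out inn by blast
  have "card (fst ` set p) = length p" using d(1) by (metis distinct_card length_map list.set_map)
  moreover have "card {u, a, b} \<le> 3" by (auto simp: card_insert_if)
  ultimately have "\<not> fst ` set p \<subseteq> {u, a, b}"
    using p card_mono[of "{u, a, b}" "fst ` set p"] by auto
  then obtain v where v: "v \<in> fst ` set p" "v \<noteq> u" "v \<noteq> a" "v \<noteq> b" by blast
  then have "(u, v) \<in> parcs (split_graph V K)" using u V by (auto simp: split_graph_def)
  then show "\<exists>u v. (u, v) \<in> parcs (split_graph V K) \<and> u \<in> fst ` set p \<and> v \<in> fst ` set p \<and>
    (u, v) \<notin> set p \<and> (v, u) \<notin> set p"
    using u v ab by blast
qed

lemma card_clique_le_clique_number:
  assumes "finite (pverts H)" "is_clique H K"
  shows "card K \<le> clique_number H"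
  unfolding clique_number_def
proof (rule Max_ge)
  show "finite {card K |K. is_clique H K}"
    by (rule finite_subset[of _ "{..card (pverts H)}"])
       (use assms in \<open>auto simp: is_clique_def card_mono\<close>)
qed (use assms in auto)

text \<open>The complete graph on the vertices of \<open>G\<close> is chordal, so the
  \<open>LEAST\<close> is attained. As subtraction truncates, the clique number is bounded by
  \<open>treewidth G + 1\<close> rather than equal to it.\<close>

lemma treewidth_witness:
  assumes "pair_graph G"
  obtains H where "pair_graph H" "subgraph (with_proj G) (with_proj H)" "chordal H"
    "clique_number H \<le> treewidth G + 1"
proof -
  let ?P = "\<lambda>w. \<exists>H. pair_graph H \<and> subgraph (with_proj G) (with_proj H) \<and> chordal H \<and>
                   clique_number H = w"
  let ?H = "split_graph (pverts G) (pverts G)"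
  have H: "pair_graph ?H" using finite_pverts[OF assms] by (rule pair_graph_split_graph)
  have "subgraph (with_proj G) (with_proj ?H)"
    unfolding subgraph_def
    using wf_digraph_pair_graph[OF assms] wf_digraph_pair_graph[OF H] parcs_subset[OF assms]
      irrefl_parcs[OF assms]
    by (auto simp: split_graph_def)
  then have "?P (clique_number ?H)" using H chordal_split_graph by blast
  then have "?P (LEAST w. ?P w)" by (rule LeastI)
  then show thesis using that unfolding treewidth_def by (metis le_diff_conv order_refl)
qed

section \<open>Separators and the halving recursion in terms of treewidth\<close>

lemma connected_on_mono:
  assumes "connected_on E A" "E \<subseteq> E'"
  shows "connected_on E' A"
proof -
  have "closed_in E A X" if "closed_in E' A X" for X
    using that assms(2) by (auto simp: closed_in_def)
  then show ?thesis using assms(1) by (simp add: connected_on_def)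
qed

text \<open>A component of \<open>A - K\<close> in \<open>G\<close> is connected in the supergraph,
  hence lies in one of the components there, which meets \<open>A\<close> in at most half of
  \<open>A\<close>. The clique \<open>K\<close> need not lie in \<open>A\<close>.\<close>

lemma treewidth_balanced_separator:
  assumes "pair_graph G" "A \<subseteq> pverts G"
  shows "\<exists>K. finite K \<and> card K \<le> treewidth G + 1 \<and>
    (\<forall>D\<in>components (parcs G) (A - K). 2 * card D \<le> card A)"
proof -
  obtain H where H: "pair_graph H" "subgraph (with_proj G) (with_proj H)" "chordal H"
    "clique_number H \<le> treewidth G + 1"
    by (rule treewidth_witness[OF assms(1)])
  have symH: "sym (parcs H)" using sym_parcs[OF H(1)] .
  have sub: "pverts G \<subseteq> pverts H" "parcs G \<subseteq> parcs H" using H(2) by (auto simp: subgraph_def)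
  have finA: "finite A" using assms(2) finite_pverts[OF assms(1)] by (rule finite_subset)
  obtain K where K: "is_clique H K"
    and bal: "\<And>D. D \<in> components (parcs H) (pverts H - K) \<Longrightarrow> 2 * card (D \<inter> A) \<le> card A"
    using chordal_balanced_separator[OF H(1,3) finA] by blast
  have "2 * card D \<le> card A" if D: "D \<in> components (parcs G) (A - K)" for D
  proof -
    have DA: "D \<subseteq> A - K" using components_subset[OF D] .
    obtain x where x: "x \<in> D" using components_nonempty[OF D] by blast
    obtain D' where D': "D' \<in> components (parcs H) (pverts H - K)" "x \<in> D'"
      using components_exists[OF symH, of x "pverts H - K"] x DA assms(2) sub by blast
    have "connected_on (parcs H) D" using components_connected_on[OF D] sub(2) by (rule connected_on_mono)
    then have "D \<subseteq> D'" using connected_on_subset_comp[OF _ _ D'(1)] DA assms(2) sub x D'(2) by blast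
    then have "card D \<le> card (D' \<inter> A)" using DA finA by (intro card_mono) auto
    then show ?thesis using bal[OF D'(1)] by simp
  qed
  moreover have "finite K"
    using K finite_subset[OF _ finite_pverts[OF H(1)]] unfolding is_clique_def by blast
  moreover have "card K \<le> treewidth G + 1"
    using card_clique_le_clique_number[OF finite_pverts[OF H(1)] K] H(4) by simp
  ultimately show ?thesis by blast
qed

text \<open>Each halving costs at most \<open>(treewidth G + 1) * card A\<close> for the separator,
  and \<open>j\<close> bounds the number of halvings.\<close>

lemma eccentricity_le_treewidth:
  assumes "pair_graph G" "A \<subseteq> pverts G" "connected_on (parcs G) A" "card A < 2 ^ j"
  shows "eccentricity_le (parcs G) A (j * (treewidth G + 1) * card A)"
  using assms(2-4)
proof (induction j arbitrary: A)
  case 0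
  then have "A = {}" using finite_subset[OF _ finite_pverts[OF assms(1)]] by (simp add: card_eq_0_iff)
  then show ?case using 0 by (simp add: connected_on_def)
next
  case (Suc j)
  have sym: "sym (parcs G)" using sym_parcs[OF assms(1)] .
  have finA: "finite A" using Suc.prems(1) finite_pverts[OF assms(1)] by (rule finite_subset)
  obtain K where K: "finite K" "card K \<le> treewidth G + 1"
    and half: "\<And>D. D \<in> components (parcs G) (A - K) \<Longrightarrow> 2 * card D \<le> card A"
    using treewidth_balanced_separator[OF assms(1) Suc.prems(1)] by blast
  have "eccentricity_le (parcs G) D (j * (treewidth G + 1) * card D)" if D: "D \<in> components (parcs G) (A - K)" for D
    using half[OF D] components_subset[OF D] components_connected_on[OF D] Suc.prems by (intro Suc.IH) auto
  then have "eccentricity_le (parcs G) A ((card K + j * (treewidth G + 1)) * card A)"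
    by (intro eccentricity_le_separator[OF sym K(1) finA Suc.prems(2)])
  moreover have "(card K + j * (treewidth G + 1)) * card A \<le> Suc j * (treewidth G + 1) * card A"
    using K(2) by (intro mult_right_mono) auto
  ultimately show ?case by (rule eccentricity_le_mono)
qed


section \<open>From induced subgraphs to vertex sets\<close>

text \<open>A normal form for the subgraphs that \<open>search_tree\<close> meets: with the
  projections as tail and head, such a graph is determined by its vertex set.\<close>

definition induced :: "'a rel \<Rightarrow> 'a set \<Rightarrow> ('a, 'a \<times> 'a) pre_digraph" where
  "induced E A = \<lparr> verts = A, arcs = E \<inter> A \<times> A, tail = fst, head = snd \<rparr>"

lemma induced_simps [simp]:
  "verts (induced E A) = A" "arcs (induced E A) = E \<inter> A \<times> A" "tail (induced E A) = fst" "head (induced E A) = snd"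
  by (simp_all add: induced_def)

lemma arcs_ends_induced [simp]: "arcs_ends (induced E A) = E \<inter> A \<times> A"
  by (simp add: arcs_ends_conv)

lemma wf_digraph_induced: "wf_digraph (induced E A)"
  by unfold_locales auto

lemma induced_subgraph_induced:
  "induced_subgraph H (induced E A) \<longleftrightarrow> (\<exists>C\<subseteq>A. H = induced E C)"
proof
  assume H: "induced_subgraph H (induced E A)"
  then have sub: "verts H \<subseteq> A" and "tail H = fst" "head H = snd"
    by (auto simp: induced_subgraph_def subgraph_def compatible_def)
  moreover have "arcs H = {e \<in> E \<inter> A \<times> A. fst e \<in> verts H \<and> snd e \<in> verts H}"
    using H by (simp add: induced_subgraph_def)
  then have "arcs H = E \<inter> verts H \<times> verts H" using sub by auto
  ultimately have "H = induced E (verts H)" by (intro pre_digraph.equality) auto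
  then show "\<exists>C\<subseteq>A. H = induced E C" using sub by blast
next
  assume "\<exists>C\<subseteq>A. H = induced E C"
  then show "induced_subgraph H (induced E A)"
    using wf_digraph_induced by (fastforce simp: induced_subgraph_def subgraph_def compatible_def)
qed

text \<open>A closed set absorbs every walk that starts in it, and the set reachable from a vertex
  is closed.\<close>

lemma strongly_connected_induced: "strongly_connected (induced E A) \<longleftrightarrow> connected_on E A"
proof
  assume sc: "strongly_connected (induced E A)"
  have "X = A" if X: "closed_in E A X" "X \<noteq> {}" for X
  proof -
    obtain u where u: "u \<in> X" using X by blast
    have "v \<in> X" if "v \<in> A" for v
    proof -
      have "(u, v) \<in> rtrancl_on A (E \<inter> A \<times> A)"
        using sc u X that unfolding strongly_connected_def reachable_def closed_in_def by auto
      then show ?thesis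
      proof (induction rule: rtrancl_on_induct)
        case (step x y)
        then show ?case using X(1) by (auto simp: closed_in_def)
      qed (use u in auto)
    qed
    then show ?thesis using X(1) by (auto simp: closed_in_def)
  qed
  moreover have "A \<noteq> {}" using sc by (simp add: strongly_connected_def)
  ultimately show "connected_on E A" by (simp add: connected_on_def)
next
  assume c: "connected_on E A"
  have "(u, v) \<in> rtrancl_on A (E \<inter> A \<times> A)" if "u \<in> A" "v \<in> A" for u v
  proof -
    let ?X = "{v \<in> A. (u, v) \<in> rtrancl_on A (E \<inter> A \<times> A)}"
    have "closed_in E A ?X"
      unfolding closed_in_def by (auto intro: rtrancl_on_into_rtrancl_on)
    moreover have "u \<in> ?X" using that by auto
    ultimately have "?X = A" using c unfolding connected_on_def by blast
    then show ?thesis using that by blast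
  qed
  then show "strongly_connected (induced E A)"
    using c by (auto simp: strongly_connected_def reachable_def connected_on_def)
qed

text \<open>The library takes maximal strongly connected induced subgraphs. Every vertex lies in a
  component, and a connected set meeting a component lies inside it; so components are the maximal
  connected sets.\<close>

lemma sccs_induced:
  assumes "sym E"
  shows "pre_digraph.sccs (induced E A) = induced E ` components E A"
proof -
  have larger: "(\<exists>H'. (\<exists>C'\<subseteq>A. H' = induced E C') \<and> strongly_connected H' \<and> X \<subset> verts H') \<longleftrightarrow>
    (\<exists>C'. C' \<subseteq> A \<and> connected_on E C' \<and> X \<subset> C')" for X
    by (metis induced_simps(1) strongly_connected_induced)
  have "pre_digraph.sccs (induced E A) =
    induced E ` {C. C \<subseteq> A \<and> connected_on E C \<and> \<not> (\<exists>C'. C' \<subseteq> A \<and> connected_on E C' \<and> C \<subset> C')}"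
    unfolding pre_digraph.sccs_def induced_subgraph_induced larger
    by (auto simp: strongly_connected_induced)
  also have "{C. C \<subseteq> A \<and> connected_on E C \<and> \<not> (\<exists>C'. C' \<subseteq> A \<and> connected_on E C' \<and> C \<subset> C')} = components E A"
  proof (intro subset_antisym subsetI)
    fix C assume "C \<in> {C. C \<subseteq> A \<and> connected_on E C \<and> \<not> (\<exists>C'. C' \<subseteq> A \<and> connected_on E C' \<and> C \<subset> C')}"
    then have C: "C \<subseteq> A" "connected_on E C" "\<And>C'. C' \<subseteq> A \<Longrightarrow> connected_on E C' \<Longrightarrow> \<not> C \<subset> C'" by auto
    then obtain x where x: "x \<in> C" by (auto simp: connected_on_def)
    then obtain D where D: "D \<in> components E A" "x \<in> D" using components_exists[OF assms] C(1) by blast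
    then have "C \<subseteq> D" using connected_on_subset_comp[OF C(2,1) D(1)] x by blast
    then have "C = D" using C(3)[OF components_subset[OF D(1)] components_connected_on[OF D(1)]] by blast
    then show "C \<in> components E A" using D by simp
  next
    fix C assume C: "C \<in> components E A"
    have "\<not> (\<exists>C'. C' \<subseteq> A \<and> connected_on E C' \<and> C \<subset> C')"
    proof
      assume "\<exists>C'. C' \<subseteq> A \<and> connected_on E C' \<and> C \<subset> C'"
      then obtain C' where C': "C' \<subseteq> A" "connected_on E C'" "C \<subset> C'" by blast
      then have "C' \<subseteq> C" using connected_on_subset_comp[OF C'(2,1) C] components_nonempty[OF C] by blast
      then show False using C' by blast
    qed
    then show "C \<in> {C. C \<subseteq> A \<and> connected_on E C \<and> \<not> (\<exists>C'. C' \<subseteq> A \<and> connected_on E C' \<and> C \<subset> C')}"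
      using components_subset[OF C] components_connected_on[OF C] by blast
  qed
  finally show ?thesis .
qed

lemma del_vert_induced: "pre_digraph.del_vert (induced E A) r = induced E (A - {r})"
  unfolding pre_digraph.del_vert_def by (auto simp: induced_def)

text \<open>The choice functions of the two definitions are translated by composing with
  \<open>induced E\<close> and with \<open>verts\<close>.\<close>

lemma search_tree_induced:
  assumes "sym E"
  shows "search_tree (induced E A) T \<longleftrightarrow> search_tree_on E A T"
proof
  have "\<forall>A. G = induced E A \<longrightarrow> search_tree_on E A T" if "search_tree G T" for G
    using that
  proof induction
    case (1 r G c ts)
    show ?case
    proof (intro allI impI)
      fix A assume G: "G = induced E A"
      then have sccs: "pre_digraph.sccs (pre_digraph.del_vert G r) = induced E ` components E (A - {r})"
        by (simp add: del_vert_induced sccs_induced[OF assms])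
      show "search_tree_on E A (Node r ts)"
        by (rule search_tree_on.intros[where c = "c \<circ> induced E"]) (use 1 G sccs in \<open>auto simp: image_comp\<close>)
    qed
  qed
  then show "search_tree (induced E A) T \<Longrightarrow> search_tree_on E A T" by blast
next
  assume "search_tree_on E A T"
  then show "search_tree (induced E A) T"
  proof induction
    case (1 r A c ts)
    show ?case
      by (rule search_tree.intros[where c = "c \<circ> verts"])
         (use 1 in \<open>auto simp: del_vert_induced sccs_induced[OF assms] image_comp comp_def\<close>)
  qed
qed

lemma with_proj_eq_induced: "pair_graph G \<Longrightarrow> with_proj G = induced (parcs G) (pverts G)"
  using parcs_subset[of G] by (simp add: induced_def with_proj_def Int_absorb2)

text \<open>The library's connectivity is strong connectivity of the symmetric closure, which here
  is the graph itself.\<close>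

lemma connected_iff_connected_on:
  assumes "pair_graph G"
  shows "Digraph_Component.connected (with_proj G) \<longleftrightarrow> connected_on (parcs G) (pverts G)"
proof -
  have "mk_symmetric (with_proj G) = G"
    using symD[OF sym_parcs[OF assms]] unfolding mk_symmetric_def
    by (intro pair_pre_digraph.equality) auto
  then show ?thesis unfolding Digraph_Component.connected_def
    using strongly_connected_induced with_proj_eq_induced[OF assms] by metis
qed

lemma rotation_graph_eq:
  assumes "pair_graph G"
  shows "pverts (rotation_graph G) = {T. search_tree_on (parcs G) (pverts G) T}"
    and "parcs (rotation_graph G) = rot_rel (parcs G) (pverts G)"
proof -
  have "search_tree (with_proj G) = search_tree_on (parcs G) (pverts G)"
    unfolding with_proj_eq_induced[OF assms] by (intro ext search_tree_induced sym_parcs assms)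
  then show "pverts (rotation_graph G) = {T. search_tree_on (parcs G) (pverts G) T}"
    and "parcs (rotation_graph G) = rot_rel (parcs G) (pverts G)"
    by (simp_all add: rotation_graph_def rot_rel_def)
qed

section \<open>Walks, distances and the diameter of the rotation graph\<close>

lemma walk_iff_relpow:
  "(\<exists>p. pcas u p v \<and> set p \<subseteq> R \<and> length p = k) \<longleftrightarrow> (u, v) \<in> R ^^ k"
proof (induction k arbitrary: u)
  case (Suc k)
  have "(\<exists>p. pcas u p v \<and> set p \<subseteq> R \<and> length p = Suc k) \<longleftrightarrow>
    (\<exists>w. (u, w) \<in> R \<and> (\<exists>p. pcas w p v \<and> set p \<subseteq> R \<and> length p = k))" (is "?l = ?r")
  proof
    assume ?l
    then obtain p where p: "pcas u p v" "set p \<subseteq> R" "length p = Suc k" by blast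
    then obtain e q where "p = e # q" by (cases p) auto
    then show ?r using p by (intro exI[of _ "snd e"]) (cases e; auto)
  next
    assume ?r
    then obtain w p where "(u, w) \<in> R" "pcas w p v" "set p \<subseteq> R" "length p = k" by blast
    then show ?l by (intro exI[of _ "(u, w) # p"]) auto
  qed
  also have "\<dots> \<longleftrightarrow> (u, v) \<in> R ^^ Suc k"
    unfolding Suc.IH using relpow_Suc_I2 relpow_Suc_D2 by metis
  finally show ?case .
qed auto

lemma graph_dist_eq:
  assumes "u \<in> pverts H"
  shows "graph_dist H u v = (LEAST k. (u, v) \<in> parcs H ^^ k)"
proof -
  have "(\<exists>p. pre_digraph.awalk (with_proj H) u p v \<and> length p = k) \<longleftrightarrow> (u, v) \<in> parcs H ^^ k" for k
    unfolding walk_iff_relpow[symmetric] pre_digraph.awalk_def cas_with_proj_eq with_proj_simps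
    using assms by auto
  then show ?thesis unfolding graph_dist_def by simp
qed

lemma relpow_sym:
  assumes "sym R" "(u, v) \<in> R ^^ k"
  shows "(v, u) \<in> R ^^ k"
  using assms(2)
proof (induction k arbitrary: v)
  case (Suc k)
  then obtain w where "(u, w) \<in> R ^^ k" "(w, v) \<in> R" by auto
  then show ?case using Suc.IH symD[OF assms(1)] relpow_Suc_I2 by metis
qed auto

text \<open>Any two trees are joined through the centre \<open>T\<^sub>0\<close>. The second claim
  is what makes the diameter usable for a lower bound.\<close>

lemma eccentricity_le_diameter:
  assumes "pair_graph G" "eccentricity_le (parcs G) (pverts G) m"
  shows "assoc_diameter G \<le> 2 * m"
    and "S \<in> pverts (rotation_graph G) \<Longrightarrow> T \<in> pverts (rotation_graph G) \<Longrightarrow>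
      \<exists>k. (S, T) \<in> parcs (rotation_graph G) ^^ k \<and> k \<le> assoc_diameter G"
proof -
  let ?H = "rotation_graph G"
  let ?D = "{graph_dist ?H u v |u v. u \<in> pverts ?H \<and> v \<in> pverts ?H}"
  obtain T\<^sub>0 where T0: "T\<^sub>0 \<in> pverts ?H"
    and ecc: "\<And>T. T \<in> pverts ?H \<Longrightarrow> \<exists>k\<le>m. (T, T\<^sub>0) \<in> parcs ?H ^^ k"
    using assms(2) unfolding eccentricity_le_def rotation_graph_eq[OF assms(1)] by blast
  have ex: "\<exists>k\<le>2 * m. (S, T) \<in> parcs ?H ^^ k" if ST: "S \<in> pverts ?H" "T \<in> pverts ?H" for S T
  proof -
    obtain k l where kl: "k \<le> m" "l \<le> m" "(S, T\<^sub>0) \<in> parcs ?H ^^ k" "(T, T\<^sub>0) \<in> parcs ?H ^^ l"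
      using ecc ST by blast
    have "sym (parcs ?H)" unfolding rotation_graph_eq[OF assms(1)] by (rule sym_rot_rel)
    then have "(T\<^sub>0, T) \<in> parcs ?H ^^ l" using kl(4) by (rule relpow_sym)
    then have "(S, T) \<in> parcs ?H ^^ (k + l)" using kl(3) by (auto simp: relpow_add)
    then show ?thesis using kl by (intro exI[of _ "k + l"]) auto
  qed
  have dist: "(S, T) \<in> parcs ?H ^^ graph_dist ?H S T \<and> graph_dist ?H S T \<le> 2 * m"
    if ST: "S \<in> pverts ?H" "T \<in> pverts ?H" for S T
  proof -
    obtain k where k: "k \<le> 2 * m" "(S, T) \<in> parcs ?H ^^ k" using ex ST by blast
    show ?thesis unfolding graph_dist_eq[OF ST(1)]
      using LeastI[of "\<lambda>k. (S, T) \<in> parcs ?H ^^ k" k] Least_le[of "\<lambda>k. (S, T) \<in> parcs ?H ^^ k" k] k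
      by simp
  qed
  have sub: "?D \<subseteq> {..2 * m}" using dist by auto
  then have fin: "finite ?D" by (rule finite_subset) simp
  have "?D \<noteq> {}" using T0 by blast
  then show "assoc_diameter G \<le> 2 * m"
    unfolding assoc_diameter_def diameter_def using fin sub by (subst Max_le_iff) auto
  assume ST: "S \<in> pverts ?H" "T \<in> pverts ?H"
  then have "graph_dist ?H S T \<le> assoc_diameter G"
    unfolding assoc_diameter_def diameter_def using fin by (intro Max_ge) blast+
  then show "\<exists>k. (S, T) \<in> parcs ?H ^^ k \<and> k \<le> assoc_diameter G" using dist[OF ST] by blast
qed

lemma eccentricity_le_connected:
  assumes "pair_graph G" "Digraph_Component.connected (with_proj G)" "card (pverts G) < 2 ^ j"
  shows "eccentricity_le (parcs G) (pverts G) (j * (treewidth G + 1) * card (pverts G))"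
  using eccentricity_le_treewidth[OF assms(1) subset_refl _ assms(3)] connected_iff_connected_on[OF assms(1)] assms(2)
  by blast

lemma assoc_diameter_le:
  assumes "pair_graph G" "Digraph_Component.connected (with_proj G)" "card (pverts G) < 2 ^ j"
  shows "assoc_diameter G \<le> 2 * (j * (treewidth G + 1) * card (pverts G))"
  using eccentricity_le_diameter(1)[OF assms(1) eccentricity_le_connected[OF assms]] .

text \<open>Connectivity gives an edge, which is a clique of size two in every chordal
  supergraph.\<close>

lemma treewidth_pos:
  assumes "pair_graph G" "Digraph_Component.connected (with_proj G)" "2 \<le> card (pverts G)"
  shows "1 \<le> treewidth G"
proof -
  obtain H where H: "pair_graph H" "subgraph (with_proj G) (with_proj H)" "chordal H"
    "clique_number H \<le> treewidth G + 1"
    by (rule treewidth_witness[OF assms(1)])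
  have connected_on: "connected_on (parcs G) (pverts G)" using connected_iff_connected_on[OF assms(1)] assms(2) by blast
  then obtain x where x: "x \<in> pverts G" by (auto simp: connected_on_def)
  have "{x} \<noteq> pverts G"
  proof
    assume "{x} = pverts G"
    then have "card (pverts G) = card {x}" by (simp only:)
    then show False using assms(3) by simp
  qed
  then have "\<not> closed_in (parcs G) (pverts G) {x}" using connected_on unfolding connected_on_def by blast
  then obtain y where y: "(x, y) \<in> parcs G" "y \<noteq> x" using x by (auto simp: closed_in_def)
  then have "(x, y) \<in> parcs H" using H(2) by (auto simp: subgraph_def)
  moreover have "(y, x) \<in> parcs H" using symD[OF sym_parcs[OF H(1)] calculation] .
  ultimately have "is_clique H {x, y}"
    using parcs_subset[OF H(1)] by (auto simp: is_clique_def)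
  then have "card {x, y} \<le> clique_number H"
    using card_clique_le_clique_number[OF finite_pverts[OF H(1)]] by blast
  then show ?thesis using H(4) y by simp
qed

section \<open>Edge orientations\<close>

lemma vertices_in_tubes:
  assumes "search_tree_on E A T" "sym E" "finite A"
  shows "A \<in> tubes T"
  using assms by (induction rule: search_tree_on_induct) simp

text \<open>The vertex of least key is made the root at every stage. An edge leaving a tube leads to
  an earlier root, because the other end stays in the same component until it is deleted. Integer
  keys serve an order on naturals and its reverse.\<close>

lemma search_tree_on_exists_by_key:
  fixes f :: "'a \<Rightarrow> int"
  assumes "sym E" "finite A" "A \<noteq> {}" "inj_on f A"
  shows "\<exists>T. search_tree_on E A T \<and> (\<forall>\<tau>\<in>tubes T. \<forall>u\<in>\<tau>. \<forall>v\<in>A - \<tau>. (u, v) \<in> E \<longrightarrow> f v < f u)"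
  using assms(2-4)
proof (induction "card A" arbitrary: A rule: less_induct)
  case less
  obtain r where r: "r \<in> A" "\<And>x. x \<in> A \<Longrightarrow> f r \<le> f x"
    using less.prems by (metis arg_min_if_finite(1) arg_min_least)
  let ?F = "components E (A - {r})"
  have "\<exists>T. search_tree_on E C T \<and> (\<forall>\<tau>\<in>tubes T. \<forall>u\<in>\<tau>. \<forall>v\<in>C - \<tau>. (u, v) \<in> E \<longrightarrow> f v < f u)"
    if C: "C \<in> ?F" for C
  proof (rule less.hyps)
    have "C \<subset> A" using components_subset[OF C] r(1) by blast
    then show "card C < card A" using less.prems(1) by (rule psubset_card_mono[rotated])
    show "finite C" using \<open>C \<subset> A\<close> less.prems(1) by (rule finite_subset[OF psubset_imp_subset])
    show "inj_on f C" using less.prems(3) \<open>C \<subset> A\<close> by (rule inj_on_subset[OF _ psubset_imp_subset])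
    show "C \<noteq> {}" using components_nonempty[OF C] .
  qed
  then have "\<forall>C\<in>?F. \<exists>T. search_tree_on E C T \<and> (\<forall>\<tau>\<in>tubes T. \<forall>u\<in>\<tau>. \<forall>v\<in>C - \<tau>. (u, v) \<in> E \<longrightarrow> f v < f u)"
    by blast
  from bchoice[OF this] obtain c where "\<forall>C\<in>?F. search_tree_on E C (c C) \<and>
      (\<forall>\<tau>\<in>tubes (c C). \<forall>u\<in>\<tau>. \<forall>v\<in>C - \<tau>. (u, v) \<in> E \<longrightarrow> f v < f u)" ..
  then have c: "search_tree_on E C (c C)"
    and key: "\<And>\<tau> u v. \<tau> \<in> tubes (c C) \<Longrightarrow> u \<in> \<tau> \<Longrightarrow> v \<in> C - \<tau> \<Longrightarrow> (u, v) \<in> E \<Longrightarrow> f v < f u"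
    if "C \<in> ?F" for C using that by simp_all
  have "f v < f u"
    if \<tau>: "\<tau> \<in> tubes (tree_node r ?F c)" "u \<in> \<tau>" "v \<in> A - \<tau>" and uv: "(u, v) \<in> E" for \<tau> u v
  proof -
    have "\<tau> \<noteq> A" using \<tau> by blast
    then obtain C where C: "C \<in> ?F" "\<tau> \<in> tubes (c C)"
      using \<tau>(1) tubes_tree_node[OF assms(1) less.prems(1) r(1) c] by auto
    have fC: "finite C" using components_subset[OF C(1)] less.prems(1) by (meson finite_Diff finite_subset)
    have u: "u \<in> C" using tubes_subset[OF c[OF C(1)] assms(1) fC C(2)] \<tau>(2) by blast
    show ?thesis
    proof (cases "v = r")
      case True
      have "u \<in> A" "u \<noteq> r" using u components_subset[OF C(1)] by blast+
      then show ?thesis using r True less.prems(3) by (metis inj_onD order_le_less)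
    next
      case False
      then have "v \<in> C" using components_closed[OF C(1) u _ uv] \<tau>(3) by blast
      then show ?thesis using key[OF C \<tau>(2) _ uv] \<tau>(3) by simp
    qed
  qed
  then show ?case using search_tree_on_tree_node[OF less.prems(1) r(1), of E c] c by blast
qed

text \<open>Adjacent vertices share a component until one of them is made root; from then on only
  the other one lies in tubes.\<close>

lemma edge_ordered:
  assumes "search_tree_on E A T" "sym E" "finite A" "u \<in> A" "v \<in> A" "u \<noteq> v" "(u, v) \<in> E"
  shows "(\<exists>\<tau>\<in>tubes T. u \<in> \<tau> \<and> v \<notin> \<tau>) \<longleftrightarrow> \<not> (\<exists>\<tau>\<in>tubes T. v \<in> \<tau> \<and> u \<notin> \<tau>)"
  using assms
proof (induction rule: search_tree_on_induct)
  case (tree_node A r c)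
  let ?F = "components E (A - {r})" and ?T = "tree_node r (components E (A - {r})) c"
  have tubes: "tubes ?T = insert A (\<Union>C\<in>?F. tubes (c C))" by fact
  have fin: "finite C" if "C \<in> ?F" for C
    using components_subset[OF that] tree_node.hyps(1) by (meson finite_Diff finite_subset)
  have sub: "\<tau> \<subseteq> C" if "C \<in> ?F" "\<tau> \<in> tubes (c C)" for C \<tau>
    using tubes_subset[OF tree_node.hyps(3)[OF that(1)] assms(2) fin[OF that(1)] that(2)] by blast
  have root: "(\<exists>\<tau>\<in>tubes ?T. x \<in> \<tau> \<and> r \<notin> \<tau>) \<and> \<not> (\<exists>\<tau>\<in>tubes ?T. r \<in> \<tau> \<and> x \<notin> \<tau>)"
    if x: "x \<in> A" "x \<noteq> r" for x
  proof
    obtain C where C: "C \<in> ?F" "x \<in> C" using components_exists[OF assms(2), of x "A - {r}"] x by blast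
    have "C \<in> tubes (c C)" using vertices_in_tubes[OF tree_node.hyps(3)[OF C(1)] assms(2) fin[OF C(1)]] .
    then show "\<exists>\<tau>\<in>tubes ?T. x \<in> \<tau> \<and> r \<notin> \<tau>"
      using C components_subset[OF C(1)] unfolding tubes by blast
    show "\<not> (\<exists>\<tau>\<in>tubes ?T. r \<in> \<tau> \<and> x \<notin> \<tau>)"
      using x sub components_subset[of _ E "A - {r}"] unfolding tubes by blast
  qed
  consider "u = r" | "v = r" | "u \<noteq> r" "v \<noteq> r" by blast
  then show ?case
  proof cases
    case 1
    then show ?thesis using root[of v] tree_node.prems by blast
  next
    case 2
    then show ?thesis using root[of u] tree_node.prems by blast
  next
    case 3
    then obtain C where C: "C \<in> ?F" "u \<in> C"
      using components_exists[OF assms(2), of u "A - {r}"] tree_node.prems by blast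
    have v: "v \<in> C" using components_closed[OF C] tree_node.prems 3 by blast
    have eq: "(\<exists>\<tau>\<in>tubes ?T. x \<in> \<tau> \<and> y \<notin> \<tau>) \<longleftrightarrow> (\<exists>\<tau>\<in>tubes (c C). x \<in> \<tau> \<and> y \<notin> \<tau>)"
      if xy: "x \<in> C" "y \<in> C" for x y
    proof
      assume "\<exists>\<tau>\<in>tubes ?T. x \<in> \<tau> \<and> y \<notin> \<tau>"
      then obtain \<tau> where \<tau>: "\<tau> \<in> tubes ?T" "x \<in> \<tau>" "y \<notin> \<tau>" by blast
      have "y \<in> A" using xy components_subset[OF C(1)] by blast
      then obtain D where D: "D \<in> ?F" "\<tau> \<in> tubes (c D)" using \<tau> unfolding tubes by blast
      then have "D = C" using sub[OF D] components_disjoint[OF D(1) C(1)] \<tau>(2) xy(1) by blast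
      then show "\<exists>\<tau>\<in>tubes (c C). x \<in> \<tau> \<and> y \<notin> \<tau>" using D \<tau> by blast
    next
      assume "\<exists>\<tau>\<in>tubes (c C). x \<in> \<tau> \<and> y \<notin> \<tau>"
      then show "\<exists>\<tau>\<in>tubes ?T. x \<in> \<tau> \<and> y \<notin> \<tau>" using C(1) unfolding tubes by blast
    qed
    show ?thesis using tree_node.IH[OF C(1) C(2) v] tree_node.prems eq[OF C(2) v] eq[OF v C(2)] by blast
  qed
qed

text \<open>\<open>a\<close> is the root of the subtree with vertex set \<open>\<tau>\<close>; every
  other vertex lies in the tube of one of its children.\<close>

lemma tube_root:
  assumes "search_tree_on E A T" "sym E" "finite A" "\<tau> \<in> tubes T"
  shows "\<exists>a. \<forall>u\<in>\<tau>. u \<noteq> a \<longrightarrow> (\<exists>\<sigma>\<in>tubes T. \<sigma> \<subset> \<tau> \<and> u \<in> \<sigma>)"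
  using assms
proof (induction rule: search_tree_on_induct)
  case (tree_node A r c)
  let ?F = "components E (A - {r})" and ?T = "tree_node r (components E (A - {r})) c"
  have tubes: "tubes ?T = insert A (\<Union>C\<in>?F. tubes (c C))" by fact
  show ?case
  proof (cases "\<tau> = A")
    case True
    have "\<exists>\<sigma>\<in>tubes ?T. \<sigma> \<subset> A \<and> u \<in> \<sigma>" if u: "u \<in> A" "u \<noteq> r" for u
    proof -
      obtain C where C: "C \<in> ?F" "u \<in> C" using components_exists[OF assms(2), of u "A - {r}"] u by blast
      have "finite C" using components_subset[OF C(1)] tree_node.hyps(1) by (meson finite_Diff finite_subset)
      then have "C \<in> tubes (c C)" using vertices_in_tubes[OF tree_node.hyps(3)[OF C(1)] assms(2)] by blast
      then show ?thesis using C components_subset[OF C(1)] tree_node.hyps(2) unfolding tubes by blast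
    qed
    then show ?thesis using True by blast
  next
    case False
    then obtain C where C: "C \<in> ?F" "\<tau> \<in> tubes (c C)" using tree_node.prems unfolding tubes by blast
    then have sub: "tubes (c C) \<subseteq> tubes ?T" unfolding tubes by blast
    from tree_node.IH[OF C] obtain a
      where a: "\<forall>u\<in>\<tau>. u \<noteq> a \<longrightarrow> (\<exists>\<sigma>\<in>tubes (c C). \<sigma> \<subset> \<tau> \<and> u \<in> \<sigma>)" ..
    have "\<exists>\<sigma>\<in>tubes ?T. \<sigma> \<subset> \<tau> \<and> u \<in> \<sigma>" if u: "u \<in> \<tau>" "u \<noteq> a" for u
    proof -
      obtain \<sigma> where "\<sigma> \<in> tubes (c C)" "\<sigma> \<subset> \<tau> \<and> u \<in> \<sigma>" using a u by (elim ballE bexE) auto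
      then show ?thesis using subsetD[OF sub] by (intro bexI[of _ \<sigma>])
    qed
    then show ?thesis by (intro exI[of _ a]) simp
  qed
qed

text \<open>
  In a search tree the endpoints of an edge are comparable; a tube containing only \<open>u\<close> witnesses
  that \<open>v\<close> is the ancestor.
\<close>

definition inversions :: "('a::linorder) rel \<Rightarrow> 'a set \<Rightarrow> 'a stree \<Rightarrow> 'a rel" where
  "inversions E A T = {(u, v) \<in> E. u \<in> A \<and> v \<in> A \<and> u < v \<and> (\<exists>\<tau>\<in>tubes T. u \<in> \<tau> \<and> v \<notin> \<tau>)}"

lemma finite_inversions: "finite A \<Longrightarrow> finite (inversions E A T)"
  by (rule finite_subset[of _ "A \<times> A"]) (auto simp: inversions_def)

lemma card_inversions_rot:
  assumes "sym E" "finite A" "(S, T) \<in> rot_rel E A"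
  shows "card (inversions E A T) \<le> Suc (card (inversions E A S))"
proof -
  have search_tree_on: "search_tree_on E A S" "search_tree_on E A T" and rot_rel: "rotation S T" using assms(3) by (auto simp: rot_rel_def)
  note cS = card_tubes[OF search_tree_on(1) assms(1,2)] and cT = card_tubes[OF search_tree_on(2) assms(1,2)]
  \<comment> \<open>Equal numbers of tubes turn a symmetric difference of size two into one tube on
    each side.\<close>
  have "card (tubes S - tubes T) = card (tubes T - tubes S)"
    using cS cT by (metis card_Diff_subset_Int finite_Int inf_commute)
  moreover have "card ((tubes S - tubes T) \<union> (tubes T - tubes S)) =
    card (tubes S - tubes T) + card (tubes T - tubes S)"
    using cS cT by (intro card_Un_disjoint) auto
  ultimately have "card (tubes S - tubes T) = 1" "card (tubes T - tubes S) = 1"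
    using rot_rel by (auto simp: rotation_def)
  then obtain \<alpha> \<beta> where \<alpha>: "tubes S - tubes T = {\<alpha>}" and \<beta>: "tubes T - tubes S = {\<beta>}"
    by (meson card_1_singletonE)
  obtain a where a: "\<And>u. u \<in> \<alpha> \<Longrightarrow> u \<noteq> a \<Longrightarrow> \<exists>\<sigma>\<in>tubes S. \<sigma> \<subset> \<alpha> \<and> u \<in> \<sigma>"
    using tube_root[OF search_tree_on(1) assms(1,2), of \<alpha>] \<alpha> by blast
  obtain b where b: "\<And>u. u \<in> \<beta> \<Longrightarrow> u \<noteq> b \<Longrightarrow> \<exists>\<sigma>\<in>tubes T. \<sigma> \<subset> \<beta> \<and> u \<in> \<sigma>"
    using tube_root[OF search_tree_on(2) assms(1,2), of \<beta>] \<beta> by blast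
  \<comment> \<open>A newly inverted edge is separated by \<open>\<beta>\<close> in \<open>T\<close>
    and, the other way round, by \<open>\<alpha>\<close> in \<open>S\<close>. If \<open>u\<close>
    were not the root \<open>b\<close> of \<open>\<beta>\<close>, a smaller tube around
    \<open>u\<close> would belong to both trees and still exclude \<open>v\<close>; likewise for
    \<open>v\<close> and \<open>a\<close>.\<close>
  have "inversions E A T - inversions E A S \<subseteq> {(b, a)}"
  proof
    fix e assume e: "e \<in> inversions E A T - inversions E A S"
    obtain u v where uv: "e = (u, v)" by (cases e)
    have E: "(u, v) \<in> E" "u \<in> A" "v \<in> A" "u \<noteq> v"
      and T: "\<exists>\<tau>\<in>tubes T. u \<in> \<tau> \<and> v \<notin> \<tau>" and nS: "\<not> (\<exists>\<tau>\<in>tubes S. u \<in> \<tau> \<and> v \<notin> \<tau>)"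
      using e by (auto simp: uv inversions_def)
    have nT: "\<not> (\<exists>\<tau>\<in>tubes T. v \<in> \<tau> \<and> u \<notin> \<tau>)"
      using edge_ordered[OF search_tree_on(2) assms(1,2) E(2,3,4,1)] T by blast
    have S: "\<exists>\<tau>\<in>tubes S. v \<in> \<tau> \<and> u \<notin> \<tau>"
      using edge_ordered[OF search_tree_on(1) assms(1,2) E(2,3,4,1)] nS by blast
    have \<beta>uv: "u \<in> \<beta>" "v \<notin> \<beta>" using T nS \<beta> by blast+
    have \<alpha>uv: "v \<in> \<alpha>" "u \<notin> \<alpha>" using S nT \<alpha> by blast+
    have "u = b"
    proof (rule ccontr)
      assume "u \<noteq> b"
      then obtain \<sigma> where \<sigma>: "\<sigma> \<in> tubes T" "\<sigma> \<subset> \<beta>" "u \<in> \<sigma>" using b \<beta>uv(1) by blast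
      then have "\<sigma> \<in> tubes S" using \<beta> by blast
      then show False using nS \<sigma> \<beta>uv by blast
    qed
    moreover have "v = a"
    proof (rule ccontr)
      assume "v \<noteq> a"
      then obtain \<sigma> where \<sigma>: "\<sigma> \<in> tubes S" "\<sigma> \<subset> \<alpha>" "v \<in> \<sigma>" using a \<alpha>uv(1) by blast
      then have "\<sigma> \<in> tubes T" using \<alpha> by blast
      then show False using nT \<sigma> \<alpha>uv by blast
    qed
    ultimately show "e \<in> {(b, a)}" by (simp add: uv)
  qed
  then have "inversions E A T \<subseteq> insert (b, a) (inversions E A S)" by blast
  then have "card (inversions E A T) \<le> card (insert (b, a) (inversions E A S))"
    using finite_inversions[OF assms(2)] by (intro card_mono) auto
  also have "\<dots> \<le> Suc (card (inversions E A S))"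
    using finite_inversions[OF assms(2)] by (simp add: card_insert_if)
  finally show ?thesis .
qed

lemma card_inversions_relpow:
  assumes "sym E" "finite A" "(S, T) \<in> rot_rel E A ^^ k"
  shows "card (inversions E A T) \<le> k + card (inversions E A S)"
  using assms(3)
proof (induction k arbitrary: T)
  case (Suc k)
  then obtain R where R: "(S, R) \<in> rot_rel E A ^^ k" "(R, T) \<in> rot_rel E A" by auto
  show ?case using Suc.IH[OF R(1)] card_inversions_rot[OF assms(1,2) R(2)] by simp
qed auto

text \<open>The search trees of two opposite elimination orders differ in the orientation of every edge.\<close>

lemma card_edges_le_assoc_diameter:
  fixes G :: "nat pair_pre_digraph"
  assumes "pair_graph G" "Digraph_Component.connected (with_proj G)"
  shows "card {(u, v) \<in> parcs G. u < v} \<le> assoc_diameter G"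
proof -
  let ?E = "parcs G" and ?V = "pverts G"
  have sym: "sym ?E" using sym_parcs[OF assms(1)] .
  have fin: "finite ?V" using finite_pverts[OF assms(1)] .
  have ne: "?V \<noteq> {}" using assms by (simp add: connected_iff_connected_on connected_on_def)
  have key: "inj_on int ?V" "inj_on (\<lambda>x. - int x) ?V" by (auto simp: inj_on_def)
  obtain S where S: "search_tree_on ?E ?V S"
    and S_key: "\<And>\<tau> u v. \<tau> \<in> tubes S \<Longrightarrow> u \<in> \<tau> \<Longrightarrow> v \<in> ?V - \<tau> \<Longrightarrow> (u, v) \<in> ?E \<Longrightarrow> int v < int u"
    using search_tree_on_exists_by_key[OF sym fin ne key(1)] by blast
  obtain T where T: "search_tree_on ?E ?V T"
    and T_key: "\<And>\<tau> u v. \<tau> \<in> tubes T \<Longrightarrow> u \<in> \<tau> \<Longrightarrow> v \<in> ?V - \<tau> \<Longrightarrow> (u, v) \<in> ?E \<Longrightarrow> - int v < - int u"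
    using search_tree_on_exists_by_key[OF sym fin ne key(2)] by blast
  have "inversions ?E ?V S = {}"
    using S_key by (fastforce simp: inversions_def)
  moreover have "{(u, v) \<in> ?E. u < v} \<subseteq> inversions ?E ?V T"
  proof
    fix e assume "e \<in> {(u, v) \<in> ?E. u < v}"
    then obtain u v where e: "e = (u, v)" and uv: "(u, v) \<in> ?E" "u < v" by blast
    have V: "u \<in> ?V" "v \<in> ?V" using parcs_subset[OF assms(1)] uv(1) by blast+
    have "\<not> (\<exists>\<tau>\<in>tubes T. v \<in> \<tau> \<and> u \<notin> \<tau>)"
      using T_key[of _ v u] symD[OF sym uv(1)] V uv(2) by force
    then have "\<exists>\<tau>\<in>tubes T. u \<in> \<tau> \<and> v \<notin> \<tau>"
      using edge_ordered[OF T sym fin V _ uv(1)] uv(2) by blast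
    then show "e \<in> inversions ?E ?V T" using e uv V by (simp add: inversions_def)
  qed
  \<comment> \<open>\<open>n < 2 ^ n\<close> supplies some eccentricity bound; any would do, as it
    only has to ensure that the distance is attained.\<close>
  moreover obtain k where k: "(S, T) \<in> rot_rel ?E ?V ^^ k" "k \<le> assoc_diameter G"
    using eccentricity_le_diameter(2)[OF assms(1) eccentricity_le_connected[OF assms less_exp], of S T] S T
    unfolding rotation_graph_eq[OF assms(1)] by blast
  ultimately show ?thesis
    using card_inversions_relpow[OF sym fin k(1)] card_mono[OF finite_inversions[OF fin], of "{(u, v) \<in> ?E. u < v}" ?E T]
    by simp
qed

section \<open>Extremal graphs and the asymptotic bounds\<close>

text \<open>Vertices outside \<open>K\<close> are pairwise non-adjacent, so a clique contains at
  most one of them.\<close>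

lemma clique_number_split_graph:
  assumes "finite V" "finite K"
  shows "clique_number (split_graph V K) \<le> card K + 1"
  unfolding clique_number_def
proof (subst Max_le_iff)
  let ?G = "split_graph V K"
  have bound: "card L \<le> card K + 1" if L: "is_clique ?G L" for L
  proof -
    have "L \<subseteq> V" using L by (simp add: is_clique_def split_graph_def)
    then have fin: "finite L" using assms(1) finite_subset by blast
    have "card (L - K) \<le> 1"
      unfolding One_nat_def using L fin by (subst card_le_Suc0_iff_eq) (auto simp: is_clique_def split_graph_def)
    moreover have "card (L \<inter> K) \<le> card K" using assms(2) by (intro card_mono) auto
    moreover have "card L = card (L \<inter> K) + card (L - K)"
      using fin by (simp add: card_Int_Diff)
    ultimately show ?thesis by simp
  qed
  then show "\<forall>a\<in>{card L |L. is_clique ?G L}. a \<le> card K + 1" by blast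
  show "finite {card L |L. is_clique ?G L}"
    by (rule finite_subset[of _ "{..card K + 1}"]) (use bound in auto)
  have "is_clique ?G {}" by (simp add: is_clique_def)
  then show "{card L |L. is_clique ?G L} \<noteq> {}" by blast
qed

lemma treewidth_split_graph:
  assumes "finite V" "finite K"
  shows "treewidth (split_graph V K) \<le> card K"
proof -
  let ?G = "split_graph V K"
  have G: "pair_graph ?G" using pair_graph_split_graph[OF assms(1)] .
  have "subgraph (with_proj ?G) (with_proj ?G)"
    using wf_digraph_pair_graph[OF G] by (auto simp: subgraph_def)
  then have "(LEAST w. \<exists>H. pair_graph H \<and> subgraph (with_proj ?G) (with_proj H) \<and> chordal H \<and>
      clique_number H = w) \<le> clique_number ?G"
    using G chordal_split_graph by (intro Least_le) blast
  then show ?thesis using clique_number_split_graph[OF assms] unfolding treewidth_def by linarith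
qed

lemma connected_split_graph:
  assumes "finite V" "w \<in> K" "w \<in> V"
  shows "Digraph_Component.connected (with_proj (split_graph V K))"
proof -
  let ?G = "split_graph V K"
  have "X = V" if X: "closed_in (parcs ?G) V X" "X \<noteq> {}" for X
  proof -
    obtain x where x: "x \<in> X" "x \<in> V" using X by (auto simp: closed_in_def)
    have nb: "(x, w) \<in> parcs ?G \<and> (w, x) \<in> parcs ?G" if "x \<in> V" "x \<noteq> w" for x
      using that assms(2,3) by (simp add: split_graph_def)
    have "w \<in> X" using X(1) x nb[of x] assms(3) unfolding closed_in_def by blast
    then have "V \<subseteq> X" using X(1) nb unfolding closed_in_def by blast
    then show ?thesis using X(1) by (auto simp: closed_in_def)
  qed
  then have "connected_on (parcs ?G) V" using assms(3) by (auto simp: connected_on_def)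
  moreover have "pverts ?G = V" by (simp add: split_graph_def)
  ultimately show ?thesis
    using connected_iff_connected_on[OF pair_graph_split_graph[OF assms(1)], of K] by simp
qed

text \<open>Each \<open>u < k\<close> is the smaller end of \<open>n - Suc u\<close> edges. Their
  sum is \<open>k * n - k * (k + 1) / 2\<close>, and \<open>k + 1 \<le> n\<close> leaves at least
  half of \<open>k * n\<close>.\<close>

lemma card_edges_split_graph:
  assumes "k < n"
  shows "k * n \<le> 2 * card {(u, v) \<in> parcs (split_graph {..<n} {..<k}). u < v}"
proof -
  have "{(u, v) \<in> parcs (split_graph {..<n} {..<k}). u < v} = Sigma {..<k} (\<lambda>u. {u<..<n})"
    using assms by (auto simp: split_graph_def)
  then have card: "card {(u, v) \<in> parcs (split_graph {..<n} {..<k}). u < v} = (\<Sum>u<k. n - Suc u)"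
    by simp
  have "k \<le> n \<Longrightarrow> 2 * (\<Sum>u<k. n - Suc u) + k * (k + 1) = 2 * n * k"
  proof (induction k)
    case (Suc k)
    then have "2 * (n - Suc k) + 2 * Suc k = 2 * n"
      and "2 * (\<Sum>u<k. n - Suc u) + k * (k + 1) = 2 * n * k" by simp_all
    then show ?case unfolding sum.lessThan_Suc distrib_left mult_Suc_right by simp
  qed simp
  then have "2 * (\<Sum>u<k. n - Suc u) + k * (k + 1) = 2 * (k * n)"
    using assms by (simp add: mult_ac)
  moreover have "k * (k + 1) \<le> k * n" using assms by (intro mult_left_mono) auto
  ultimately show ?thesis using card by linarith
qed

text \<open>\<open>Sup\<close> on the naturals is known to dominate a set only if the set is
  bounded. The crude \<open>n < 2 ^ n\<close> is enough for that.\<close>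

lemma bdd_above_assoc_diameter:
  "bdd_above {assoc_diameter G | G :: nat pair_pre_digraph.
     pair_graph G \<and> Digraph_Component.connected (with_proj G) \<and>
     treewidth G \<le> k \<and> card (pverts G) = n}"
proof (rule bdd_aboveI)
  fix d assume "d \<in> {assoc_diameter G | G :: nat pair_pre_digraph.
     pair_graph G \<and> Digraph_Component.connected (with_proj G) \<and>
     treewidth G \<le> k \<and> card (pverts G) = n}"
  then obtain G :: "nat pair_pre_digraph" where G: "pair_graph G"
    "Digraph_Component.connected (with_proj G)" "treewidth G \<le> k" "card (pverts G) = n"
    "d = assoc_diameter G" by blast
  have "d \<le> 2 * (n * (treewidth G + 1) * n)"
    using assoc_diameter_le[OF G(1,2) less_exp] G(4,5) by simp
  also have "\<dots> \<le> 2 * (n * (k + 1) * n)" using G(3) by (intro mult_mono) auto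
  finally show "d \<le> 2 * (n * (k + 1) * n)" .
qed

text \<open>The clique size \<open>k\<close> of the extremal graph is kept apart from the allowed
  treewidth \<open>l\<close>, since \<open>l\<close> may exceed \<open>n - 1\<close>.\<close>

lemma max_assoc_diameter_ge:
  assumes "1 \<le> k" "k \<le> l" "k < n"
  shows "k * n \<le> 2 * max_assoc_diameter l n"
proof -
  let ?G = "split_graph {..<n} {..<k}"
  have G: "pair_graph ?G" by (rule pair_graph_split_graph) simp
  have c: "Digraph_Component.connected (with_proj ?G)"
    using assms by (intro connected_split_graph[where w = 0]) auto
  have tw: "treewidth ?G \<le> l" using treewidth_split_graph[of "{..<n}" "{..<k}"] assms by simp
  have "pverts ?G = {..<n}" by (simp add: split_graph_def)
  then have "assoc_diameter ?G \<le> max_assoc_diameter l n"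
    unfolding max_assoc_diameter_def using G c tw
    by (intro cSup_upper bdd_above_assoc_diameter CollectI exI[of _ ?G]) simp
  then show ?thesis
    using card_edges_le_assoc_diameter[OF G c] card_edges_split_graph[OF assms(3)] by linarith
qed

lemma max_assoc_diameter_le:
  assumes "2 \<le> n" "n < 2 ^ j"
  shows "max_assoc_diameter k n \<le> 4 * (j * k * n)"
proof -
  let ?D = "{assoc_diameter G | G :: nat pair_pre_digraph.
     pair_graph G \<and> Digraph_Component.connected (with_proj G) \<and>
     treewidth G \<le> k \<and> card (pverts G) = n}"
  have bound: "d \<le> 4 * (j * k * n)" if d: "d \<in> ?D" for d
  proof -
    obtain G :: "nat pair_pre_digraph" where G: "pair_graph G"
      "Digraph_Component.connected (with_proj G)" "treewidth G \<le> k" "card (pverts G) = n"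
      "d = assoc_diameter G" using d by blast
    have "1 \<le> treewidth G" using treewidth_pos[OF G(1,2)] G(4) assms(1) by simp
    \<comment> \<open>Positive treewidth absorbs the summand 1, so that the final bound is
      proportional to \<open>k\<close>.\<close>
    then have tw: "treewidth G + 1 \<le> 2 * k" using G(3) by simp
    have "d \<le> 2 * (j * (treewidth G + 1) * n)"
      using assoc_diameter_le[OF G(1,2), of j] G(4,5) assms(2) by simp
    also have "\<dots> \<le> 2 * (j * (2 * k) * n)" using tw by (intro mult_mono) auto
    finally show ?thesis by (simp add: mult_ac)
  qed
  show ?thesis
  proof (cases "?D = {}")
    \<comment> \<open>This happens for \<open>k = 0\<close>; the supremum of the empty set is
      0.\<close>
    case True
    then show ?thesis unfolding max_assoc_diameter_def by (simp only: True) (simp add: Sup_nat_def)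
  next
    case False
    then show ?thesis unfolding max_assoc_diameter_def using bound by (rule cSup_least)
  qed
qed

lemma real_max_assoc_diameter_ge:
  assumes "0 \<le> C" "real k \<le> C * real n" "2 \<le> n"
  shows "real k * real n \<le> 2 * (1 + 2 * C) * real (max_assoc_diameter k n)"
proof (cases "k = 0")
  case True
  then show ?thesis using assms(1) by simp
next
  case False
  define l where "l = min k (n - 1)"
  have l: "1 \<le> l" "l \<le> k" "l < n" using False assms(3) by (auto simp: l_def)
  \<comment> \<open>Either \<open>l = k\<close>, or \<open>l = n - 1\<close> and
    \<open>k \<le> C * n \<le> 2 * C * l\<close>, because \<open>n \<le> 2 * (n - 1)\<close> for
    \<open>n \<ge> 2\<close>. The constant adds the factors of the two cases.\<close>
  have "real k \<le> (1 + 2 * C) * real l"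
  proof (cases "k \<le> n - 1")
    case True
    then have "real k = 1 * real l" by (simp add: l_def)
    also have "\<dots> \<le> (1 + 2 * C) * real l" using assms(1) by (intro mult_right_mono) auto
    finally show ?thesis .
  next
    case False
    then have "real n \<le> 2 * real l" using assms(3) by (simp add: l_def)
    then have "C * real n \<le> C * (2 * real l)" using assms(1) by (intro mult_left_mono)
    then show ?thesis using assms(2) by (simp add: algebra_simps)
  qed
  then have "real k * real n \<le> (1 + 2 * C) * real l * real n"
    by (intro mult_right_mono) auto
  also have "\<dots> = (1 + 2 * C) * real (l * n)" by simp
  also have "\<dots> \<le> (1 + 2 * C) * real (2 * max_assoc_diameter k n)"
    using max_assoc_diameter_ge[OF l] assms(1) by (intro mult_left_mono of_nat_mono) auto
  finally show ?thesis by (simp add: algebra_simps)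
qed

lemma real_max_assoc_diameter_le:
  assumes "2 \<le> n"
  shows "real (max_assoc_diameter k n) \<le> (8 / ln 2) * (real k * real n * ln (real n))"
proof -
  \<comment> \<open>\<open>i\<close> is the integer part of the binary logarithm. As
    \<open>n \<ge> 2\<close>, \<open>i + 1\<close> is at most \<open>2 * i\<close>, which turns the
    factor 4 into 8; \<open>ln 2\<close> comes from the change of base.\<close>
  obtain i where i: "2 ^ i \<le> n" "n < 2 ^ (i + 1)"
    using ex_power_ivl1[of 2 n] assms by auto
  have "i \<noteq> 0"
  proof
    assume "i = 0"
    then show False using i(2) assms by simp
  qed
  have "max_assoc_diameter k n \<le> 4 * ((i + 1) * k * n)"
    by (rule max_assoc_diameter_le[OF assms i(2)])
  also have "\<dots> \<le> 4 * ((2 * i) * k * n)"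
    using \<open>i \<noteq> 0\<close> by (intro mult_le_mono) auto
  finally have "real (max_assoc_diameter k n) \<le> real (4 * ((2 * i) * k * n))"
    by (rule of_nat_mono)
  also have "\<dots> = 8 * (real i * (real k * real n))" by simp
  also have "\<dots> \<le> 8 * ((ln (real n) / ln 2) * (real k * real n))"
  proof -
    have "real (2 ^ i) \<le> real n" using i(1) by (rule of_nat_mono)
    then have "ln (2 ^ i) \<le> ln (real n)" using assms by (intro ln_mono) auto
    then have "real i \<le> ln (real n) / ln 2" by (simp add: ln_realpow field_simps)
    then show ?thesis by (intro mult_left_mono mult_right_mono) auto
  qed
  finally show ?thesis by (simp add: mult_ac)
qed

text \<open>The growth condition guards the lower bound: a graph on \<open>n\<close> vertices has
  treewidth at most \<open>n - 1\<close>, so the maximum no longer grows with \<open>tw n\<close>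
  beyond that, and \<open>tw n = n ^ 2\<close>, for example, would violate the lower bound.\<close>

theorem theorem5:
  fixes tw :: "nat \<Rightarrow> nat"
  shows "((\<lambda>n. real (tw n)) \<in> O(\<lambda>n. real n) \<longrightarrow>
            (\<lambda>n. real (max_assoc_diameter (tw n) n)) \<in> \<Omega>(\<lambda>n. real (tw n) * real n)) \<and>
         (\<lambda>n. real (max_assoc_diameter (tw n) n)) \<in> O(\<lambda>n. real (tw n) * real n * ln (real n))"
proof (intro conjI impI)
  assume "(\<lambda>n. real (tw n)) \<in> O(\<lambda>n. real n)"
  then obtain C where C: "C > 0" and ev: "\<forall>\<^sub>F n in at_top. real (tw n) \<le> C * real n"
    by (auto simp: bigo_def)
  let ?c = "1 / (2 * (1 + 2 * C))"
  have "\<forall>\<^sub>F n in at_top. norm (real (max_assoc_diameter (tw n) n)) \<ge> ?c * norm (real (tw n) * real n)"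
    using ev eventually_ge_at_top[of 2]
  proof (rule eventually_elim2)
    fix n assume n: "real (tw n) \<le> C * real n" "2 \<le> n"
    have "real (tw n) * real n / (2 * (1 + 2 * C)) \<le> real (max_assoc_diameter (tw n) n)"
      using real_max_assoc_diameter_ge[of C "tw n" n] C n by (simp add: pos_divide_le_eq mult.commute)
    then show "norm (real (max_assoc_diameter (tw n) n)) \<ge> ?c * norm (real (tw n) * real n)" by simp
  qed
  moreover have "?c > 0" using C by simp
  ultimately show "(\<lambda>n. real (max_assoc_diameter (tw n) n)) \<in> \<Omega>(\<lambda>n. real (tw n) * real n)"
    unfolding bigomega_def by blast
next
  have "norm (real (max_assoc_diameter (tw n) n)) \<le> 8 / ln 2 * norm (real (tw n) * real n * ln (real n))"
    if "2 \<le> n" for n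
    using real_max_assoc_diameter_le[OF that, of "tw n"] that by (simp add: abs_mult)
  then have "\<forall>\<^sub>F n in at_top. norm (real (max_assoc_diameter (tw n) n)) \<le>
      8 / ln 2 * norm (real (tw n) * real n * ln (real n))"
    using eventually_at_top_linorder by blast
  moreover have "8 / ln 2 > (0 :: real)" by simp
  ultimately show "(\<lambda>n. real (max_assoc_diameter (tw n) n)) \<in> O(\<lambda>n. real (tw n) * real n * ln (real n))"
    unfolding bigo_def by blast
qed

end
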